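(* Given a finite, bipartite, planar graph $G$ with a dimer model with Kasteleyn operator $K$, the following conditions are equivalent: (1) The face-weight partition function is invariant under shrinking/expanding of $2$-valent vertices. (2) Given any white (resp. black) $2$-valent vertex $w$ (resp. $b$) with adjacent vertices $b_1,b_2$ (resp. $w_1,w_2$), we have $K_{w,b_1}+K_{w,b_2}=0$ (resp. $K_{w_1,b}+K_{w_2,b}=0$). In such a case, the kernel of $K:\mathbb C^B\to\mathbb C^W$ is invariant under shrinking/expanding of $2$-valent vertices, up to canonical isomorphism.
   Context: $G$ is a finite bipartite planar graph with black and white vertex sets $B,W$. Edge weights may be arbitrary non-zero complex numbers. A Kasteleyn operator $K:\mathbb C^B\to\mathbb C^W$, $(Kf)_w=\sum_bK_{w,b}f_b$, has non-zero coefficients exactly on edges, and the face weight of a bounded face $f$ with boundary vertices $w_1,b_1,w_2,\dots,w_n,b_n$ in counterclockwise order is $\mathcal W_f=(-1)^{n+1}\prod_{j=1}^n\frac{K_{w_j,b_j}}{K_{w_j,b_{j-1}}}$ (cyclic indices; this is the alternating product of the edge weights, the sign accounting for the Kasteleyn phase). Given a reference dimer configuration (perfect matching) $M_1$, the height function $h_M$ of a dimer configuration $M$ is the function on faces with $M-M_1=\partial(\sum_fh_M(f)f)$ (edges oriented from white to black), normalized to vanish on the outer face, and the face-weight partition function is $Z(G,\mathcal W)=\sum_M\prod_f\mathcal W_f^{h_M(f)}$. Shrinking a $2$-valent vertex $x$ with distinct neighbours $x_1,x_2$: contract both edges at $x$, so that $x,x_1,x_2$ merge into a single vertex of the colour of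 $x_1,x_2$, giving a graph $G'$ whose faces correspond to those of $G$; expanding is the inverse operation. The Kasteleyn coefficients of the edges not affected by the move (all the edges of $G'$) are unchanged, and $K'$ is the corresponding operator for $G'$. Invariance of the face-weight partition function means $Z(G,\mathcal W)=Z(G',\mathcal W')$ for corresponding reference configurations, understood at the level of face weights: the weights of all corresponding faces of $G$ and $G'$ coincide. Invariance of the kernel up to canonical isomorphism means that $\ker K$ and $\ker K'$ are canonically isomorphic.
   Formalization: (1) implies (2) is proved only for graphs in which no 2-valent vertex with distinct neighbours has the same face on both sides (its edges are not bridges); without this it fails, e.g. for the path b1-w1-b2-w2, which has no bounded face. The other implications need no such assumption. *)

theory Defs
  imports Complex_Main "HOL-Combinatorics.Combinatorics"
begin

section \<open>Plane bipartite graphs\<close>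

text \<open>
  A bipartite graph drawn in the plane is encoded by its rotation system: \<open>rot_white\<close> and
  \<open>rot_black\<close> send an edge to the next edge in counterclockwise order around its white and
  its black endpoint.  Parallel edges are allowed, because contracting at a 2-valent vertex of a
  quadrilateral face creates them.

  Orient every edge from white to black.  If \<open>e\<close> has a given face on its left, then walking
  along the boundary of that face counterclockwise one leaves the black endpoint of \<open>e\<close> along
  the edge preceding \<open>e\<close> in the rotation, and then leaves the next white vertex by the same
  rule.  So the edges having a given face on their left form a cycle of
  \<open>rot_black \<circ> rot_white\<close>, the inverse of this walk.  A boundary component of a face is
  represented by this set of edges, half the number of sides of the boundary walk.

  The graph need not be connected, but no component lies inside a bounded face of another one:
  every bounded face has a boundary that is a single closed walk.  \<open>outer\<close> is the set of
  boundary components of the outer face, one for each connected component with an edge.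
\<close>

record ('v, 'e) bigraph =
  white :: "'v set"
  black :: "'v set"
  edges :: "'e set"
  wend :: "'e \<Rightarrow> 'v"
  bend :: "'e \<Rightarrow> 'v"
  rot_white :: "'e \<Rightarrow> 'e"
  rot_black :: "'e \<Rightarrow> 'e"
  outer :: "'e set set"

definition incident :: "('v, 'e) bigraph \<Rightarrow> 'v \<Rightarrow> 'e set" where
  "incident G v = {e \<in> edges G. wend G e = v \<or> bend G e = v}"

definition left_face :: "('v, 'e) bigraph \<Rightarrow> 'e \<Rightarrow> 'e set" where
  "left_face G e = orbit (rot_black G \<circ> rot_white G) e"

definition right_face :: "('v, 'e) bigraph \<Rightarrow> 'e \<Rightarrow> 'e set" where
  "right_face G e = left_face G (rot_black G e)"

definition faces :: "('v, 'e) bigraph \<Rightarrow> 'e set set" where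
  "faces G = left_face G ` edges G"

definition bounded_faces :: "('v, 'e) bigraph \<Rightarrow> 'e set set" where
  "bounded_faces G = faces G - outer G"

text \<open>Edge sets of the connected components; isolated vertices do not appear here.\<close>

definition components :: "('v, 'e) bigraph \<Rightarrow> 'e set set" where
  "components G =
     edges G // {(e, e'). e \<in> edges G \<and> e' \<in> edges G \<and> (wend G e = wend G e' \<or> bend G e = bend G e')}\<^sup>*"

text \<open>Planarity is Euler's formula \<open>V + F = E + 2\<close> on each component.\<close>

definition plane_bigraph :: "('v, 'e) bigraph \<Rightarrow> bool" where
  "plane_bigraph G \<longleftrightarrow>
     finite (white G) \<and> finite (black G) \<and> white G \<inter> black G = {} \<and> finite (edges G) \<and>
     wend G ` edges G \<subseteq> white G \<and> bend G ` edges G \<subseteq> black G \<and>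
     rot_white G permutes edges G \<and> rot_black G permutes edges G \<and>
     (\<forall>w \<in> white G. incident G w \<noteq> {} \<longrightarrow> cyclic_on (rot_white G) (incident G w)) \<and>
     (\<forall>b \<in> black G. incident G b \<noteq> {} \<longrightarrow> cyclic_on (rot_black G) (incident G b)) \<and>
     outer G \<subseteq> faces G \<and>
     (\<forall>C \<in> components G.
        card (wend G ` C) + card (bend G ` C) + card {f \<in> faces G. f \<subseteq> C} = card C + 2 \<and>
        (\<exists>!f. f \<in> outer G \<and> f \<subseteq> C))"

section \<open>The Kasteleyn operator\<close>

text \<open>
  \<open>\<kappa> e\<close> is the Kasteleyn coefficient of the edge \<open>e\<close>.  Parallel edges add up in the
  coefficient \<open>K_{w,b}\<close>; without parallel edges \<open>K_{w,b}\<close> is the coefficient of the edge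
  \<open>wb\<close>, or zero if there is none.  The space \<open>\<complex>\<^sup>B\<close> consists of the functions vanishing
  outside the black vertices.
\<close>

definition kast :: "('v, 'e) bigraph \<Rightarrow> ('e \<Rightarrow> complex) \<Rightarrow> 'v \<Rightarrow> 'v \<Rightarrow> complex" where
  "kast G \<kappa> w b = (\<Sum>e \<in> {e \<in> edges G. wend G e = w \<and> bend G e = b}. \<kappa> e)"

definition kast_op ::
    "('v, 'e) bigraph \<Rightarrow> ('e \<Rightarrow> complex) \<Rightarrow> ('v \<Rightarrow> complex) \<Rightarrow> 'v \<Rightarrow> complex" where
  "kast_op G \<kappa> f = (\<lambda>w. if w \<in> white G then \<Sum>b \<in> black G. kast G \<kappa> w b * f b else 0)"

definition kast_ker :: "('v, 'e) bigraph \<Rightarrow> ('e \<Rightarrow> complex) \<Rightarrow> ('v \<Rightarrow> complex) set" where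
  "kast_ker G \<kappa> = {f. (\<forall>v. v \<notin> black G \<longrightarrow> f v = 0) \<and> kast_op G \<kappa> f = (\<lambda>_. 0)}"

definition linear_iso ::
    "('v \<Rightarrow> complex) set \<Rightarrow> ('u \<Rightarrow> complex) set \<Rightarrow> (('v \<Rightarrow> complex) \<Rightarrow> 'u \<Rightarrow> complex) \<Rightarrow> bool" where
  "linear_iso S T \<Phi> \<longleftrightarrow> bij_betw \<Phi> S T \<and>
     (\<forall>f \<in> S. \<forall>g \<in> S. \<Phi> (\<lambda>v. f v + g v) = (\<lambda>v. \<Phi> f v + \<Phi> g v)) \<and>
     (\<forall>c. \<forall>f \<in> S. \<Phi> (\<lambda>v. c * f v) = (\<lambda>v. c * \<Phi> f v))"

section \<open>Face weights, heights and the partition function\<close>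

text \<open>
  A face with boundary vertices \<open>w\<^sub>1, b\<^sub>1, \<dots>, w\<^sub>n, b\<^sub>n\<close> is the set of the \<open>n\<close> edges
  \<open>w\<^sub>j b\<^sub>j\<close>, and the edge joining \<open>b_{j-1}\<close> to \<open>w\<^sub>j\<close> on its boundary walk is the successor of
  \<open>w\<^sub>j b\<^sub>j\<close> in the rotation at \<open>w\<^sub>j\<close>.
\<close>

definition face_weight :: "('v, 'e) bigraph \<Rightarrow> ('e \<Rightarrow> complex) \<Rightarrow> 'e set \<Rightarrow> complex" where
  "face_weight G \<kappa> f = (-1) ^ (card f + 1) * (\<Prod>e \<in> f. \<kappa> e / \<kappa> (rot_white G e))"

definition dimer_config :: "('v, 'e) bigraph \<Rightarrow> 'e set \<Rightarrow> bool" where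
  "dimer_config G M \<longleftrightarrow> M \<subseteq> edges G \<and> (\<forall>v \<in> white G \<union> black G. \<exists>!e. e \<in> M \<and> e \<in> incident G v)"

text \<open>
  \<open>M - M\<^sub>1 = \<partial> (\<Sum>\<^sub>f h(f) f)\<close>, read off at each edge: the boundary of a face traverses the
  edges having it on their left positively and those having it on their right negatively.
\<close>

definition is_height :: "('v, 'e) bigraph \<Rightarrow> 'e set \<Rightarrow> 'e set \<Rightarrow> ('e set \<Rightarrow> int) \<Rightarrow> bool" where
  "is_height G M1 M h \<longleftrightarrow>
     (\<forall>f. f \<notin> bounded_faces G \<longrightarrow> h f = 0) \<and>
     (\<forall>e \<in> edges G. of_bool (e \<in> M) - of_bool (e \<in> M1) = h (left_face G e) - h (right_face G e))"

text \<open>In a plane graph the height function exists and is unique, so the default is not used.\<close>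

definition height :: "('v, 'e) bigraph \<Rightarrow> 'e set \<Rightarrow> 'e set \<Rightarrow> 'e set \<Rightarrow> int" where
  "height G M1 M = (if \<exists>!h. is_height G M1 M h then THE h. is_height G M1 M h else (\<lambda>_. 0))"

definition face_partition :: "('v, 'e) bigraph \<Rightarrow> ('e \<Rightarrow> complex) \<Rightarrow> 'e set \<Rightarrow> complex" where
  "face_partition G \<kappa> M1 =
     (\<Sum>M | dimer_config G M. \<Prod>f \<in> bounded_faces G. face_weight G \<kappa> f powi height G M1 M f)"

section \<open>Shrinking 2-valent vertices\<close>

definition other_end :: "('v, 'e) bigraph \<Rightarrow> 'v \<Rightarrow> 'e \<Rightarrow> 'v" where
  "other_end G x e = (if wend G e = x then bend G e else wend G e)"

definition two_valent :: "('v, 'e) bigraph \<Rightarrow> 'v \<Rightarrow> 'e \<Rightarrow> 'e \<Rightarrow> bool" where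
  "two_valent G x e1 e2 \<longleftrightarrow>
     x \<in> white G \<union> black G \<and> incident G x = {e1, e2} \<and> e1 \<noteq> e2 \<and>
     other_end G x e1 \<noteq> other_end G x e2"

text \<open>
  The vertex into which \<open>x\<close> and its neighbours \<open>x\<^sub>1, x\<^sub>2\<close> merge is named \<open>x\<^sub>1\<close>.
\<close>

definition merge :: "('v, 'e) bigraph \<Rightarrow> 'v \<Rightarrow> 'e \<Rightarrow> 'e \<Rightarrow> 'v \<Rightarrow> 'v" where
  "merge G x e1 e2 v = (if v = x \<or> v = other_end G x e2 then other_end G x e1 else v)"

text \<open>
  If \<open>\<sigma>\<close> has cycles \<open>(e\<^sub>1 a\<^sub>1 \<dots> a\<^sub>p)\<close> and \<open>(e\<^sub>2 c\<^sub>1 \<dots> c\<^sub>q)\<close>, they are replaced by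
  \<open>(a\<^sub>1 \<dots> a\<^sub>p c\<^sub>1 \<dots> c\<^sub>q)\<close>, the counterclockwise order around the merged vertex; either list may
  be empty.  If \<open>\<sigma>\<close> has the cycle \<open>(e\<^sub>1 e\<^sub>2)\<close>, as the rotation of the colour of \<open>x\<close> does,
  that cycle is deleted.  So the same operation applies to both rotations.
\<close>

definition splice_rot :: "'e \<Rightarrow> 'e \<Rightarrow> ('e \<Rightarrow> 'e) \<Rightarrow> 'e \<Rightarrow> 'e" where
  "splice_rot e1 e2 \<sigma> e =
     (if e = e1 \<or> e = e2 then e
      else if \<sigma> e = e1 then (if \<sigma> e2 = e2 then \<sigma> e1 else \<sigma> e2)
      else if \<sigma> e = e2 then (if \<sigma> e1 = e1 then \<sigma> e2 else \<sigma> e1)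
      else \<sigma> e)"

text \<open>
  The face \<open>f\<close> of \<open>G\<close> corresponds to the face \<open>f - {e\<^sub>1, e\<^sub>2}\<close> of the contracted graph, and the
  dimer configuration \<open>M\<close> to \<open>M - {e\<^sub>1, e\<^sub>2}\<close>.  An outer boundary walk disappears when it
  consists only of the two contracted edges, leaving an isolated vertex.
\<close>

definition shrink :: "('v, 'e) bigraph \<Rightarrow> 'v \<Rightarrow> 'e \<Rightarrow> 'e \<Rightarrow> ('v, 'e) bigraph" where
  "shrink G x e1 e2 =
     \<lparr> white = white G - {x, other_end G x e2},
       black = black G - {x, other_end G x e2},
       edges = edges G - {e1, e2},
       wend = merge G x e1 e2 \<circ> wend G,
       bend = merge G x e1 e2 \<circ> bend G,
       rot_white = splice_rot e1 e2 (rot_white G),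
       rot_black = splice_rot e1 e2 (rot_black G),
       outer = (\<lambda>f. f - {e1, e2}) ` outer G - {{}} \<rparr>"

section \<open>The conditions\<close>

definition partition_invariant :: "('v, 'e) bigraph \<Rightarrow> ('e \<Rightarrow> complex) \<Rightarrow> bool" where
  "partition_invariant G \<kappa> \<longleftrightarrow>
     (\<forall>x e1 e2. two_valent G x e1 e2 \<longrightarrow>
        (\<forall>f \<in> bounded_faces G.
           face_weight G \<kappa> f = face_weight (shrink G x e1 e2) \<kappa> (f - {e1, e2})) \<and>
        (\<forall>M1. dimer_config G M1 \<longrightarrow>
           face_partition G \<kappa> M1 = face_partition (shrink G x e1 e2) \<kappa> (M1 - {e1, e2})))"

definition two_valent_sum_zero :: "('v, 'e) bigraph \<Rightarrow> ('e \<Rightarrow> complex) \<Rightarrow> bool" where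
  "two_valent_sum_zero G \<kappa> \<longleftrightarrow>
     (\<forall>w \<in> white G. \<forall>b1 b2. card (incident G w) = 2 \<and> b1 \<noteq> b2 \<and> bend G ` incident G w = {b1, b2}
        \<longrightarrow> kast G \<kappa> w b1 + kast G \<kappa> w b2 = 0) \<and>
     (\<forall>b \<in> black G. \<forall>w1 w2. card (incident G b) = 2 \<and> w1 \<noteq> w2 \<and> wend G ` incident G b = {w1, w2}
        \<longrightarrow> kast G \<kappa> w1 b + kast G \<kappa> w2 b = 0)"

text \<open>
  The isomorphism is canonical: it does not change the values of a function at the black vertices
  other than \<open>x\<close>, up to the identification of the vertices that merge.  This determines it
  uniquely.
\<close>

definition kernel_invariant :: "('v, 'e) bigraph \<Rightarrow> ('e \<Rightarrow> complex) \<Rightarrow> bool" where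
  "kernel_invariant G \<kappa> \<longleftrightarrow>
     (\<forall>x e1 e2. two_valent G x e1 e2 \<longrightarrow>
        (\<exists>\<Phi>. linear_iso (kast_ker G \<kappa>) (kast_ker (shrink G x e1 e2) \<kappa>) \<Phi> \<and>
           (\<forall>f \<in> kast_ker G \<kappa>. \<forall>b \<in> black G - {x}. \<Phi> f (merge G x e1 e2 b) = f b)))"

text \<open>
  The two sides of an edge belong to the same face exactly if the edge is a bridge.  The boundary
  walk of that face then passes through a 2-valent endpoint twice, in opposite directions, and the
  two coefficients there cancel from every face weight.
\<close>

definition no_two_valent_bridge :: "('v, 'e) bigraph \<Rightarrow> bool" where
  "no_two_valent_bridge G \<longleftrightarrow>
     (\<forall>x e1 e2. two_valent G x e1 e2 \<longrightarrow> left_face G e1 \<noteq> right_face G e1)"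

end

theory Submission
  imports Defs
begin

text \<open>
  Let \<open>x\<close> be a 2-valent vertex with edges \<open>e\<^sub>1, e\<^sub>2\<close> leading to \<open>x\<^sub>1, x\<^sub>2\<close>, and let
  \<open>D = {e\<^sub>1, e\<^sub>2}\<close>.  Everything rests on one observation about contraction: the face permutation
  \<open>rot_black \<circ> rot_white\<close> of the contracted graph is the first-return map, to the edges outside
  \<open>D\<close>, of the face permutation of \<open>G\<close>.  So the face on either side of a surviving edge
  merely loses the elements of \<open>D\<close> (\<open>left_face_shrink\<close>, \<open>right_face_shrink\<close>).  A face
  contained in \<open>D\<close> is the only face of a component consisting of \<open>D\<close> alone and is therefore
  outer (\<open>face_within_D_outer\<close>); hence \<open>f \<mapsto> f - D\<close> is a bijection of bounded faces.

  Partition functions.  A perfect matching contains exactly one edge of \<open>D\<close>, and the rest of the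
  matching determines which: it is the edge leading to the neighbour of \<open>x\<close> that the rest leaves
  uncovered.  So \<open>M \<mapsto> M - D\<close> is a bijection of dimer configurations.  A height function
  satisfies the same equations at the edges outside \<open>D\<close> in both graphs, and the two equations at
  \<open>D\<close> follow from the others: around any vertex both sides of the height equations sum to zero,
  because the left and right faces telescope and both matchings cover the vertex once
  (\<open>is_height_shrink_iff\<close>).  Heights therefore agree on corresponding faces, and the partition
  functions agree as soon as the face weights do.

  Face weights.  The weight of \<open>f\<close> is the weight of \<open>f - D\<close> times a factor
  \<open>- \<kappa> e / \<kappa> e'\<close> for each \<open>e \<in> f \<inter> D\<close>, where \<open>e'\<close> is the other edge of \<open>D\<close>
  (\<open>face_weight_shrink\<close>).  If \<open>\<kappa> e\<^sub>1 + \<kappa> e\<^sub>2 = 0\<close>, all these factors are 1.  Conversely, if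
  \<open>e\<^sub>1\<close> is not a bridge, its two sides are distinct faces of one component, so one of them is bounded;
  it contains exactly one edge of \<open>D\<close>, and equality of weights there forces
  \<open>\<kappa> e\<^sub>1 + \<kappa> e\<^sub>2 = 0\<close>.

  Kernels, when \<open>\<kappa> e\<^sub>1 + \<kappa> e\<^sub>2 = 0\<close>.  If \<open>x\<close> is white, the equation at \<open>x\<close> says
  \<open>f x\<^sub>1 = f x\<^sub>2\<close>, so elements of the kernel descend to the merged vertex.  If \<open>x\<close> is
  black, \<open>f x\<close> occurs in the equations at \<open>x\<^sub>1\<close> and \<open>x\<^sub>2\<close> with opposite coefficients;
  their sum is the equation at the merged vertex, and either of them recovers \<open>f x\<close>.
\<close>

section \<open>Orbits of a first-return map\<close>

text \<open>
  Iterating \<open>q\<close> visits the points of the \<open>p\<close>-orbit in the same order, leaving out those in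
  \<open>D\<close>.
\<close>

lemma orbit_first_return:
  assumes avoid: "\<And>y. y \<notin> D \<Longrightarrow> q y \<notin> D"
    and return: "\<And>y. y \<notin> D \<Longrightarrow>
      \<exists>k>0. q y = (p ^^ k) y \<and> (\<forall>j. 0 < j \<and> j < k \<longrightarrow> (p ^^ j) y \<in> D)"
    and "x \<notin> D"
  shows "orbit q x = orbit p x - D"
proof
  show "orbit q x \<subseteq> orbit p x - D"
  proof
    fix y assume "y \<in> orbit q x"
    then show "y \<in> orbit p x - D"
    proof induction
      case base
      then show ?case using return[OF \<open>x \<notin> D\<close>] avoid[OF \<open>x \<notin> D\<close>] by (auto simp: orbit_altdef)
    next
      case (step y)
      then obtain k where "q y = (p ^^ k) y" using return[of y] by auto
      then show ?case using step.IH avoid[of y] by (auto simp: funpow_in_orbit)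
    qed
  qed
next
  \<comment> \<open>strong induction on \<open>n\<close>: one step of \<open>q\<close> uses up the \<open>k\<close> steps of \<open>p\<close> until the first return\<close>
  have "(p ^^ n) y \<in> orbit q y" if "y \<notin> D" "(p ^^ n) y \<notin> D" "n > 0" for n y
    using that
  proof (induction n arbitrary: y rule: less_induct)
    case (less n)
    obtain k where k: "k > 0" "q y = (p ^^ k) y" "\<forall>j. 0 < j \<and> j < k \<longrightarrow> (p ^^ j) y \<in> D"
      using return[OF less.prems(1)] by auto
    have "k \<le> n" using k(3) less.prems by (meson not_less)
    show ?case
    proof (cases "k = n")
      case True
      then show ?thesis using k(2) by (metis orbit.base)
    next
      case False
      with \<open>k \<le> n\<close> have n: "n = (n - k) + k" "n - k > 0" "n - k < n" using k(1) by auto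
      have eq: "(p ^^ n) y = (p ^^ (n - k)) (q y)"
        unfolding k(2) by (subst n(1)) (simp add: funpow_add)
      have "(p ^^ n) y \<in> orbit q (q y)"
        unfolding eq using less.IH[OF n(3), of "q y"] avoid[OF less.prems(1)] less.prems(2) n(2) eq
        by simp
      then show ?thesis by (rule orbit_subset)
    qed
  qed
  then show "orbit p x - D \<subseteq> orbit q x" using \<open>x \<notin> D\<close> by (auto simp: orbit_altdef[of p])
qed

lemma bij_betw_orbit:
  assumes "y \<in> orbit p y"
  shows "bij_betw p (orbit p y) (orbit p y)"
proof -
  have "p ` orbit p y = orbit p (p y)" by (rule orbit_inverse[OF assms refl])
  then have "p ` orbit p y = orbit p y" using self_in_orbit_step[OF assms] by simp
  then show ?thesis
    using finite_surj_inj[OF finite_orbit[OF assms], of p] by (simp add: bij_betw_def)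
qed

section \<open>Sums over incident edges\<close>

text \<open>
  This recovers the height equation at a contracted edge from those at the other edges around a
  neighbour of \<open>x\<close>.
\<close>

lemma eq_at_if_sum_eq:
  fixes f g :: "'a \<Rightarrow> 'b :: ab_group_add"
  assumes "finite A" "e \<in> A" "sum f A = sum g A" "\<And>a. a \<in> A - {e} \<Longrightarrow> f a = g a"
  shows "f e = g e"
proof -
  have "sum f (A - {e}) = sum g (A - {e})" using assms(4) by (rule sum.cong[OF refl])
  then show ?thesis using assms(3) sum.remove[OF assms(1,2), of f] sum.remove[OF assms(1,2), of g] by simp
qed

text \<open>
  Counting the edges of \<open>M\<close> at a vertex turns the covering condition at the merged vertex into
  arithmetic.
\<close>

lemma dimer_config_card:
  "dimer_config G M \<longleftrightarrow>
     M \<subseteq> edges G \<and> (\<forall>v \<in> white G \<union> black G. card (M \<inter> incident G v) = 1)"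
proof -
  have "(\<exists>!e. e \<in> A) \<longleftrightarrow> (\<exists>a. A = {a})" for A :: "'e set" by blast
  from this[of "M \<inter> incident G v" for v]
  have "(\<exists>!e. e \<in> M \<and> e \<in> incident G v) \<longleftrightarrow> card (M \<inter> incident G v) = 1" for v
    by (simp add: card_1_singleton_iff)
  then show ?thesis unfolding dimer_config_def by simp
qed

text \<open>
  Summing over edges instead of black vertices avoids tracking which coefficients merge when
  contraction creates parallel edges.
\<close>

lemma kast_ker_iff:
  assumes "finite (edges G)" "finite (black G)" "bend G ` edges G \<subseteq> black G"
  shows "f \<in> kast_ker G \<kappa> \<longleftrightarrow> (\<forall>v. v \<notin> black G \<longrightarrow> f v = 0) \<and>
    (\<forall>w \<in> white G. (\<Sum>e \<in> {e \<in> edges G. wend G e = w}. \<kappa> e * f (bend G e)) = 0)"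
proof -
  have "(\<Sum>b\<in>black G. kast G \<kappa> w b * f b) =
      (\<Sum>e \<in> {e \<in> edges G. wend G e = w}. \<kappa> e * f (bend G e))" (is "_ = sum _ ?A") for w
  proof -
    have "kast G \<kappa> w b * f b = (\<Sum>e \<in> {e \<in> ?A. bend G e = b}. \<kappa> e * f (bend G e))" for b
      unfolding kast_def sum_distrib_right by (intro sum.cong) auto
    then have "(\<Sum>b\<in>black G. kast G \<kappa> w b * f b) =
        (\<Sum>b\<in>black G. \<Sum>e \<in> {e \<in> ?A. bend G e = b}. \<kappa> e * f (bend G e))"
      by (rule sum.cong[OF refl])
    also have "\<dots> = (\<Sum>e\<in>?A. \<kappa> e * f (bend G e))"
      using assms by (intro sum.group) auto
    finally show ?thesis .
  qed
  then show ?thesis by (auto simp: kast_ker_def kast_op_def fun_eq_iff)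
qed

section \<open>Faces, incidences and components of a plane bipartite graph\<close>

locale plane_graph =
  fixes G :: "('v, 'e) bigraph"
  assumes plane: "plane_bigraph G"
begin

abbreviation "E \<equiv> edges G"
abbreviation "rw \<equiv> rot_white G"
abbreviation "rb \<equiv> rot_black G"
abbreviation "vertices \<equiv> white G \<union> black G"

lemma finite_edges: "finite E"
  and finite_black: "finite (black G)"
  and colours_disjoint: "white G \<inter> black G = {}"
  and rw_permutes: "rw permutes E"
  and rb_permutes: "rb permutes E"
  and outer_faces: "outer G \<subseteq> faces G"
  using plane by (auto simp: plane_bigraph_def)

lemma wend_white: "e \<in> E \<Longrightarrow> wend G e \<in> white G"
  and bend_black: "e \<in> E \<Longrightarrow> bend G e \<in> black G"
  using plane by (auto simp: plane_bigraph_def)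

lemma wend_not_black: "e \<in> E \<Longrightarrow> wend G e \<notin> black G"
  and bend_not_white: "e \<in> E \<Longrightarrow> bend G e \<notin> white G"
  using wend_white bend_black colours_disjoint by blast+

lemma incident_white: "w \<in> white G \<Longrightarrow> incident G w = {e \<in> E. wend G e = w}"
  and incident_black: "b \<in> black G \<Longrightarrow> incident G b = {e \<in> E. bend G e = b}"
  using wend_not_black bend_not_white by (auto simp: incident_def)

lemma finite_incident: "finite (incident G v)"
  using finite_edges by (simp add: incident_def)

lemma rw_in [simp]: "rw e \<in> E \<longleftrightarrow> e \<in> E" and rb_in [simp]: "rb e \<in> E \<longleftrightarrow> e \<in> E"
  using permutes_in_image[OF rw_permutes] permutes_in_image[OF rb_permutes] by auto

lemma rw_eq [simp]: "rw e = rw e' \<longleftrightarrow> e = e'" and rb_eq [simp]: "rb e = rb e' \<longleftrightarrow> e = e'"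
  using permutes_inj[OF rw_permutes] permutes_inj[OF rb_permutes] by (auto simp: inj_eq)

lemma cyclic_on_white: "w \<in> white G \<Longrightarrow> e \<in> incident G w \<Longrightarrow> cyclic_on rw (incident G w)"
  and cyclic_on_black: "b \<in> black G \<Longrightarrow> e \<in> incident G b \<Longrightarrow> cyclic_on rb (incident G b)"
  using plane by (auto simp: plane_bigraph_def)

lemma wend_rw [simp]: assumes "e \<in> E" shows "wend G (rw e) = wend G e"
proof -
  have "e \<in> incident G (wend G e)" using assms by (simp add: incident_def)
  from cyclic_on_inI[OF cyclic_on_white[OF wend_white[OF assms] this] this]
  show ?thesis by (simp add: incident_white wend_white assms)
qed

lemma bend_rb [simp]: assumes "e \<in> E" shows "bend G (rb e) = bend G e"
proof -
  have "e \<in> incident G (bend G e)" using assms by (simp add: incident_def)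
  from cyclic_on_inI[OF cyclic_on_black[OF bend_black[OF assms] this] this]
  show ?thesis by (simp add: incident_black bend_black assms)
qed

text \<open>
  A rotation is cyclic on the edges at a vertex, so an edge that it fixes is a leaf edge there.
\<close>

lemma rb_fixed_alone:
  assumes "rb e = e" "e \<in> E" "d \<in> E" "bend G e = bend G d"
  shows "d = e"
proof -
  have "e \<in> incident G (bend G e)" "d \<in> incident G (bend G e)"
    using assms by (simp_all add: incident_def)
  then have "d \<in> orbit rb e"
    using orbit_cyclic_eq3[OF cyclic_on_black[OF bend_black[OF assms(2)]]] by blast
  then show ?thesis using assms(1) orbit_eq_singleton_iff[of rb e] by simp
qed

lemma rw_fixed_alone:
  assumes "rw e = e" "e \<in> E" "d \<in> E" "wend G e = wend G d"
  shows "d = e"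
proof -
  have "e \<in> incident G (wend G e)" "d \<in> incident G (wend G e)"
    using assms by (simp_all add: incident_def)
  then have "d \<in> orbit rw e"
    using orbit_cyclic_eq3[OF cyclic_on_white[OF wend_white[OF assms(2)]]] by blast
  then show ?thesis using assms(1) orbit_eq_singleton_iff[of rw e] by simp
qed

lemma face_permutation: "permutation (rb \<circ> rw)"
  using rw_permutes rb_permutes finite_edges permutation_compose permutation_permutes by blast

lemma left_face_self: "e \<in> left_face G e"
  unfolding left_face_def by (rule permutation_self_in_orbit[OF face_permutation])

lemma left_face_eqI: "e' \<in> left_face G e \<Longrightarrow> left_face G e' = left_face G e"
  unfolding left_face_def
  by (rule orbit_cyclic_eq3[OF cyclic_on_orbit'[OF face_permutation]])

lemma left_face_step: "left_face G (rb (rw e)) = left_face G e"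
  using permutation_orbit_step[OF face_permutation, of e] by (simp add: left_face_def)

lemma left_face_closed: "e' \<in> left_face G e \<Longrightarrow> rb (rw e') \<in> left_face G e"
  unfolding left_face_def using orbit.step[of e' "rb \<circ> rw" e] by simp

lemma left_face_subset: "e \<in> E \<Longrightarrow> left_face G e \<subseteq> E"
  unfolding left_face_def
  by (rule permutes_orbit_subset[OF permutes_compose[OF rw_permutes rb_permutes]])

lemma right_face_rw: "right_face G (rw e) = left_face G e"
  by (simp add: right_face_def left_face_step)

lemma face_eq_left_face: "f \<in> faces G \<Longrightarrow> e \<in> f \<Longrightarrow> f = left_face G e"
  unfolding faces_def using left_face_eqI by blast

lemma left_face_in_faces: "e \<in> E \<Longrightarrow> left_face G e \<in> faces G"
  by (simp add: faces_def)

lemma right_face_in_faces: "e \<in> E \<Longrightarrow> right_face G e \<in> faces G"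
  by (simp add: faces_def right_face_def)

lemma face_subset: "f \<in> faces G \<Longrightarrow> f \<subseteq> E"
  unfolding faces_def using left_face_subset by blast

text \<open>
  Around a vertex the right face of each edge is the left face of the neighbouring edge in the
  rotation, so the two sums differ only by a cyclic shift.
\<close>

lemma sum_left_face_eq_sum_right_face:
  assumes "v \<in> vertices"
  shows "(\<Sum>e\<in>incident G v. h (left_face G e)) = (\<Sum>e\<in>incident G v. h (right_face G e) :: int)"
proof (cases "v \<in> black G")
  case True
  from True have "inj_on rb (incident G v)" "rb ` incident G v \<subseteq> incident G v"
    by (auto simp: inj_on_def incident_black)
  then have "bij_betw rb (incident G v) (incident G v)"
    by (simp add: bij_betw_def endo_inj_surj finite_incident)
  from sum.reindex_bij_betw[OF this, of "\<lambda>e. h (left_face G e)"]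
  show ?thesis by (simp add: right_face_def)
next
  case False
  then have "v \<in> white G" using assms by simp
  then have "inj_on rw (incident G v)" "rw ` incident G v \<subseteq> incident G v"
    by (auto simp: inj_on_def incident_white)
  then have "bij_betw rw (incident G v) (incident G v)"
    by (simp add: bij_betw_def endo_inj_surj finite_incident)
  from sum.reindex_bij_betw[OF this, of "\<lambda>e. h (right_face G e)"]
  show ?thesis by (simp add: right_face_rw)
qed

text \<open>
  The relation whose closure defines the components; it is written exactly as in the definition of
  \<open>components\<close>, so that component classes need no translation.
\<close>

abbreviation adjacent :: "('e \<times> 'e) set" where
  "adjacent \<equiv> {(e, e'). e \<in> E \<and> e' \<in> E \<and> (wend G e = wend G e' \<or> bend G e = bend G e')}"

lemma component_in: "e \<in> E \<Longrightarrow> adjacent\<^sup>* `` {e} \<in> components G"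
  unfolding components_def by (rule quotientI)

lemma component_outer_ex1: "e \<in> E \<Longrightarrow> \<exists>!f. f \<in> outer G \<and> f \<subseteq> adjacent\<^sup>* `` {e}"
proof (drule component_in)
  have "\<forall>C \<in> components G. \<exists>!f. f \<in> outer G \<and> f \<subseteq> C"
    using plane unfolding plane_bigraph_def by simp
  then show "adjacent\<^sup>* `` {e} \<in> components G \<Longrightarrow> ?thesis" by (rule bspec)
qed

text \<open>
  Each rotation preserves an endpoint, so a boundary walk never leaves its component.
\<close>

lemma face_subset_component:
  assumes "e \<in> E" "e' \<in> adjacent\<^sup>* `` {e}" "e' \<in> E"
  shows "left_face G e' \<subseteq> adjacent\<^sup>* `` {e}"
proof -
  have closed: "rb (rw d) \<in> adjacent\<^sup>* `` {e} \<inter> E" if "d \<in> adjacent\<^sup>* `` {e} \<inter> E" for d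
  proof -
    have "(d, rw d) \<in> adjacent" "(rw d, rb (rw d)) \<in> adjacent" using that by auto
    moreover have "(e, d) \<in> adjacent\<^sup>*" using that by simp
    ultimately have "(e, rb (rw d)) \<in> adjacent\<^sup>*" by (meson rtrancl_into_rtrancl)
    then show ?thesis using that by simp
  qed
  have "d \<in> adjacent\<^sup>* `` {e} \<inter> E" if "d \<in> left_face G e'" for d
    using that unfolding left_face_def
  proof induction
    case base
    then show ?case using closed[of e'] assms by simp
  next
    case (step y)
    then show ?case using closed[of y] by simp
  qed
  then show ?thesis by blast
qed

text \<open>
  Both sides of an edge lie in the same component, which has only one outer face.
\<close>

lemma outer_sides_eq:
  assumes "e \<in> E" "left_face G e \<in> outer G" "right_face G e \<in> outer G"
  shows "left_face G e = right_face G e"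
proof -
  have "(e, rb e) \<in> adjacent" using assms(1) by auto
  then have "rb e \<in> adjacent\<^sup>* `` {e}" by blast
  then have "left_face G e \<subseteq> adjacent\<^sup>* `` {e}" "right_face G e \<subseteq> adjacent\<^sup>* `` {e}"
    unfolding right_face_def using face_subset_component[of e] assms(1) by simp_all
  then show ?thesis using component_outer_ex1[OF assms(1)] assms(2,3) by blast
qed

lemma closed_set_contains_outer:
  assumes "e \<in> S" "S \<subseteq> E"
    and closed: "\<And>d d'. d \<in> S \<Longrightarrow> d' \<in> E \<Longrightarrow> wend G d = wend G d' \<or> bend G d = bend G d' \<Longrightarrow> d' \<in> S"
  shows "\<exists>f \<in> outer G. f \<subseteq> S"
proof -
  have "d \<in> S" if "(e, d) \<in> adjacent\<^sup>*" for d
    using that by induction (use assms(1) closed in auto)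
  then have "adjacent\<^sup>* `` {e} \<subseteq> S" by blast
  moreover have "\<exists>f. f \<in> outer G \<and> f \<subseteq> adjacent\<^sup>* `` {e}"
    using component_outer_ex1[of e] assms(1,2) by blast
  ultimately show ?thesis by blast
qed

end

section \<open>Faces of the contracted graph\<close>

text \<open>
  The two inequations express that \<open>e1\<close> and \<open>e2\<close> lie on different cycles of \<open>\<sigma>\<close>,
  which is the situation at \<open>x1\<close> and \<open>x2\<close>.
\<close>

lemma splice_rot_notin:
  assumes "inj \<sigma>" "\<sigma> e1 \<noteq> e2" "\<sigma> e2 \<noteq> e1" "y \<notin> {e1, e2}"
  shows "splice_rot e1 e2 \<sigma> y \<notin> {e1, e2}"
proof -
  have "\<sigma> y \<noteq> \<sigma> e1" "\<sigma> y \<noteq> \<sigma> e2" using assms(1,4) by (auto simp: inj_eq)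
  then show ?thesis using assms(2-4) by (auto simp: splice_rot_def)
qed

locale shrink_move = plane_graph G for G :: "('v, 'e) bigraph" +
  fixes x :: 'v and e1 e2 :: 'e
  assumes two_valent: "two_valent G x e1 e2"
begin

abbreviation "D \<equiv> {e1, e2}"
abbreviation "G' \<equiv> shrink G x e1 e2"
abbreviation "x1 \<equiv> other_end G x e1"
abbreviation "x2 \<equiv> other_end G x e2"

lemma shrink_simps [simp]:
  "white G' = white G - {x, x2}" "black G' = black G - {x, x2}" "edges G' = E - D"
  "wend G' e = merge G x e1 e2 (wend G e)" "bend G' e = merge G x e1 e2 (bend G e)"
  "rot_white G' = splice_rot e1 e2 rw" "rot_black G' = splice_rot e1 e2 rb"
  "outer G' = (\<lambda>f. f - D) ` outer G - {{}}"
  by (simp_all add: shrink_def)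

lemma x_vertex: "x \<in> vertices"
  and incident_x: "incident G x = D"
  and e1_neq_e2: "e1 \<noteq> e2"
  and x1_neq_x2: "x1 \<noteq> x2"
  using two_valent by (auto simp: two_valent_def)

lemma e1_in: "e1 \<in> E" and e2_in: "e2 \<in> E"
  using incident_x unfolding incident_def by blast+

lemma colour_cases:
  obtains (white) "x \<in> white G" | (black) "x \<in> black G"
  using x_vertex by blast

lemma white_ends:
  assumes "x \<in> white G"
  shows "wend G e1 = x" "wend G e2 = x" "x1 = bend G e1" "x2 = bend G e2" "bend G e1 \<noteq> bend G e2"
proof -
  show "wend G e1 = x" "wend G e2 = x"
    using incident_x incident_white[OF assms] by blast+
  then show "x1 = bend G e1" "x2 = bend G e2" by (simp_all add: other_end_def)
  then show "bend G e1 \<noteq> bend G e2" using x1_neq_x2 by simp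
qed

lemma black_ends:
  assumes "x \<in> black G"
  shows "bend G e1 = x" "bend G e2 = x" "x1 = wend G e1" "x2 = wend G e2" "wend G e1 \<noteq> wend G e2"
proof -
  show "bend G e1 = x" "bend G e2 = x"
    using incident_x incident_black[OF assms] by blast+
  moreover have "wend G e1 \<noteq> x" "wend G e2 \<noteq> x"
    using wend_not_black[OF e1_in] wend_not_black[OF e2_in] assms by auto
  ultimately show "x1 = wend G e1" "x2 = wend G e2" by (simp_all add: other_end_def)
  then show "wend G e1 \<noteq> wend G e2" using x1_neq_x2 by simp
qed

lemma cyclic_on_pair:
  assumes "cyclic_on \<sigma> D"
  shows "\<sigma> e1 = e2" "\<sigma> e2 = e1"
proof -
  have *: "\<sigma> e \<in> D" "\<sigma> e \<noteq> e" if "e \<in> D" for e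
    using cyclic_on_inI[OF assms that] orbit_cyclic_eq3[OF assms that] orbit_eq_singleton_iff[of \<sigma> e]
      e1_neq_e2 by auto
  show "\<sigma> e1 = e2" "\<sigma> e2 = e1" using *[of e1] *[of e2] by auto
qed

lemma white_rot:
  assumes "x \<in> white G"
  shows "rw e1 = e2" "rw e2 = e1" "rw y = e1 \<longleftrightarrow> y = e2" "rw y = e2 \<longleftrightarrow> y = e1"
    "rb e1 \<noteq> e2" "rb e2 \<noteq> e1"
proof -
  have "cyclic_on rw D" using cyclic_on_white[OF assms, of e1] by (simp add: incident_x)
  from cyclic_on_pair[OF this] show "rw e1 = e2" "rw e2 = e1" .
  then show "rw y = e1 \<longleftrightarrow> y = e2" "rw y = e2 \<longleftrightarrow> y = e1" by (metis rw_eq)+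
  show "rb e1 \<noteq> e2" "rb e2 \<noteq> e1"
    using bend_rb[OF e1_in] bend_rb[OF e2_in] white_ends(5)[OF assms] by metis+
qed

lemma black_rot:
  assumes "x \<in> black G"
  shows "rb e1 = e2" "rb e2 = e1" "rb y = e1 \<longleftrightarrow> y = e2" "rb y = e2 \<longleftrightarrow> y = e1"
    "rw e1 \<noteq> e2" "rw e2 \<noteq> e1"
proof -
  have "cyclic_on rb D" using cyclic_on_black[OF assms, of e1] by (simp add: incident_x)
  from cyclic_on_pair[OF this] show "rb e1 = e2" "rb e2 = e1" .
  then show "rb y = e1 \<longleftrightarrow> y = e2" "rb y = e2 \<longleftrightarrow> y = e1" by (metis rb_eq)+
  show "rw e1 \<noteq> e2" "rw e2 \<noteq> e1"
    using wend_rw[OF e1_in] wend_rw[OF e2_in] black_ends(5)[OF assms] by metis+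
qed

text \<open>
  In the rotation of the colour of \<open>x\<close> the contracted edges form a cycle of their own, so
  splicing changes nothing at the other edges.
\<close>

lemma splice_rw_white: "x \<in> white G \<Longrightarrow> y \<notin> D \<Longrightarrow> splice_rot e1 e2 rw y = rw y"
  by (simp add: splice_rot_def white_rot)

lemma splice_rb_black: "x \<in> black G \<Longrightarrow> y \<notin> D \<Longrightarrow> splice_rot e1 e2 rb y = rb y"
  by (simp add: splice_rot_def black_rot)

lemma splice_rw_black_notin: "x \<in> black G \<Longrightarrow> y \<notin> D \<Longrightarrow> splice_rot e1 e2 rw y \<notin> D"
  by (rule splice_rot_notin[OF permutes_inj[OF rw_permutes] black_rot(5,6)])

lemma splice_rb_white_notin: "x \<in> white G \<Longrightarrow> y \<notin> D \<Longrightarrow> splice_rot e1 e2 rb y \<notin> D"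
  by (rule splice_rot_notin[OF permutes_inj[OF rb_permutes] white_rot(5,6)])

lemma face_step_avoid:
  assumes "y \<notin> D"
  shows "(rot_black G' \<circ> rot_white G') y \<notin> D"
proof (cases rule: colour_cases)
  case white
  have "rw y \<notin> D" using assms white_rot[OF white] by simp
  from splice_rb_white_notin[OF white this] show ?thesis
    using splice_rw_white[OF white assms] by simp
next
  case black
  have n: "splice_rot e1 e2 rw y \<notin> D" using splice_rw_black_notin[OF black assms] .
  have "rb (splice_rot e1 e2 rw y) \<notin> D" using n black_rot[OF black] by simp
  then show ?thesis using splice_rb_black[OF black n] by simp
qed

text \<open>
  A walk that meets a contracted edge runs through one edge of \<open>D\<close>, or through both if a
  neighbour of \<open>x\<close> has no further edges, and then continues at the other edges of the
  merged vertex.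
\<close>

lemma face_step_return:
  assumes "y \<notin> D"
  shows "\<exists>k>0. (rot_black G' \<circ> rot_white G') y = ((rb \<circ> rw) ^^ k) y \<and>
    (\<forall>j. 0 < j \<and> j < k \<longrightarrow> ((rb \<circ> rw) ^^ j) y \<in> D)"
proof -
  let ?p = "rb \<circ> rw" and ?q = "rot_black G' \<circ> rot_white G'"
  have "?q y = ?p y \<or> (?p y \<in> D \<and> ?q y = ?p (?p y)) \<or>
    (?p y \<in> D \<and> ?p (?p y) \<in> D \<and> ?q y = ?p (?p (?p y)))"
  proof (cases rule: colour_cases)
    case white
    have "rw y \<noteq> e1" "rw y \<noteq> e2" using assms white_rot(3,4)[OF white] by simp_all
    then show ?thesis
      using splice_rw_white[OF white assms]
      by (simp add: splice_rot_def white_rot(1,2)[OF white])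
  next
    case black
    have "splice_rot e1 e2 rb (splice_rot e1 e2 rw y) = rb (splice_rot e1 e2 rw y)"
      using splice_rb_black[OF black splice_rw_black_notin[OF black assms]] .
    then show ?thesis
      using assms by (simp add: splice_rot_def[of _ _ rw] black_rot(1,2)[OF black])
  qed
  then consider "?q y = (?p ^^ 1) y" | "?p y \<in> D" "?q y = (?p ^^ 2) y"
    | "?p y \<in> D" "?p (?p y) \<in> D" "?q y = (?p ^^ 3) y"
    by (auto simp: numeral_2_eq_2 numeral_3_eq_3)
  then show ?thesis
  proof cases
    case 1
    then show ?thesis by (intro exI[of _ 1]) auto
  next
    case 2
    then show ?thesis by (intro exI[of _ 2]) (auto simp: less_2_cases_iff)
  next
    case 3
    have "(?p ^^ j) y \<in> D" if "0 < j \<and> j < 3" for j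
    proof -
      have "j = 1 \<or> j = 2" using that by auto
      then show ?thesis using 3(1,2) by (auto simp: numeral_2_eq_2)
    qed
    then show ?thesis using 3(3) by (intro exI[of _ 3]) simp
  qed
qed

lemma left_face_shrink: "e \<notin> D \<Longrightarrow> left_face G' e = left_face G e - D"
  unfolding left_face_def by (rule orbit_first_return[OF face_step_avoid face_step_return])

lemma right_face_e1: "right_face G e1 = left_face G e2"
proof (cases rule: colour_cases)
  case white
  then show ?thesis using right_face_rw[of e2] by (simp add: white_rot)
next
  case black
  then show ?thesis by (simp add: right_face_def black_rot)
qed

text \<open>
  The right face of \<open>e\<close> is the left face of its successor in \<open>rot_black\<close>.  For white \<open>x\<close>
  splicing may change this successor, but only by moving it along the same face.
\<close>

lemma right_face_shrink:
  assumes "e \<notin> D"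
  shows "right_face G' e = right_face G e - D"
proof (cases rule: colour_cases)
  case white
  note r = white_rot[OF white]
  note e12 = left_face_step[of e1, unfolded r] left_face_step[of e2, unfolded r]
  have "left_face G (splice_rot e1 e2 rb e) = left_face G (rb e)"
    using assms e12 by (auto simp: splice_rot_def)
  then show ?thesis
    using left_face_shrink[OF splice_rb_white_notin[OF white assms]] by (simp add: right_face_def)
next
  case black
  have "rb e \<notin> D" using assms by (simp add: black_rot[OF black])
  then show ?thesis
    using left_face_shrink[of "rb e"] splice_rb_black[OF black assms] by (simp add: right_face_def)
qed

text \<open>
  If a face is contained in \<open>D\<close>, the two rotations at \<open>x1\<close> and \<open>x2\<close> must fix the
  edges of \<open>D\<close>, so both are leaves and the component is a path with two edges.  Its single face
  is the outer one.
\<close>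

lemma face_within_D_outer:
  assumes "f \<in> faces G" "f \<subseteq> D"
  shows "f \<in> outer G"
proof -
  obtain e where e: "e \<in> E" "f = left_face G e" using assms(1) by (auto simp: faces_def)
  have "e \<in> f" using e left_face_self by simp
  have step: "rb (rw d) \<in> f \<inter> D" if "d \<in> f" for d
    using left_face_closed[of d e] that e(2) assms(2) by auto
  have "f = D \<and> (\<forall>d\<in>D. \<forall>d'\<in>E. wend G d = wend G d' \<or> bend G d = bend G d' \<longrightarrow> d' \<in> D)"
  proof (cases rule: colour_cases)
    case white
    note r = white_rot[OF white]
    have "e1 \<in> f \<longrightarrow> rb e2 = e2 \<and> e2 \<in> f" "e2 \<in> f \<longrightarrow> rb e1 = e1 \<and> e1 \<in> f"
      using step[of e1] step[of e2] by (auto simp: r)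
    then have f: "f = D" and fix_rb: "rb e1 = e1" "rb e2 = e2" using \<open>e \<in> f\<close> assms(2) by auto
    have "d' \<in> D" if "d \<in> D" "d' \<in> E" "wend G d = wend G d' \<or> bend G d = bend G d'" for d d'
      using that(3)
    proof
      assume "wend G d = wend G d'"
      then have "d' \<in> incident G x" using that(1,2) white_ends[OF white] by (auto simp: incident_def)
      then show ?thesis by (simp add: incident_x)
    next
      assume "bend G d = bend G d'"
      then show ?thesis using rb_fixed_alone[of d d'] that(1,2) fix_rb e1_in e2_in by auto
    qed
    with f show ?thesis by blast
  next
    case black
    note r = black_rot[OF black]
    have "e1 \<in> f \<longrightarrow> rw e1 = e1 \<and> e2 \<in> f" "e2 \<in> f \<longrightarrow> rw e2 = e2 \<and> e1 \<in> f"
      using step[of e1] step[of e2] by (auto simp: r)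
    then have f: "f = D" and fix_rw: "rw e1 = e1" "rw e2 = e2" using \<open>e \<in> f\<close> assms(2) by auto
    have "d' \<in> D" if "d \<in> D" "d' \<in> E" "wend G d = wend G d' \<or> bend G d = bend G d'" for d d'
      using that(3)
    proof
      assume "bend G d = bend G d'"
      then have "d' \<in> incident G x" using that(1,2) black_ends[OF black] by (auto simp: incident_def)
      then show ?thesis by (simp add: incident_x)
    next
      assume "wend G d = wend G d'"
      then show ?thesis using rw_fixed_alone[of d d'] that(1,2) fix_rw e1_in e2_in by auto
    qed
    with f show ?thesis by blast
  qed
  then have f: "f = D"
    and alone: "\<And>d d'. d \<in> D \<Longrightarrow> d' \<in> E \<Longrightarrow> wend G d = wend G d' \<or> bend G d = bend G d' \<Longrightarrow> d' \<in> D"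
    by blast+
  obtain g where g: "g \<in> outer G" "g \<subseteq> D"
    using closed_set_contains_outer[of e1 D] alone e1_in e2_in by blast
  then have "g \<in> faces G" using outer_faces by blast
  moreover have "g \<noteq> {}" using \<open>g \<in> faces G\<close> left_face_self by (auto simp: faces_def)
  then obtain d where "d \<in> g" by blast
  ultimately have "g = f" using face_eq_left_face[of g d] face_eq_left_face[of f d] assms(1) f g(2) by blast
  then show ?thesis using g(1) by simp
qed

text \<open>
  Distinct faces are disjoint, so a face is determined by any edge that survives.
\<close>

lemma face_Diff_eqD:
  assumes "f \<in> faces G" "g \<in> faces G" "f - D = g - D" "f - D \<noteq> {}"
  shows "f = g"
proof -
  obtain e where "e \<in> f - D" using assms(4) by blast
  then have "e \<in> f" "e \<in> g" using assms(3) by blast+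
  then show ?thesis using face_eq_left_face assms(1,2) by metis
qed

lemma faces_shrink: "faces G' = (\<lambda>f. f - D) ` faces G - {{}}"
proof (intro equalityI subsetI)
  fix g assume "g \<in> faces G'"
  then obtain e where e: "e \<in> E" "e \<notin> D" "g = left_face G e - D"
    by (auto simp: faces_def left_face_shrink)
  then have "e \<in> g" using left_face_self by blast
  then show "g \<in> (\<lambda>f. f - D) ` faces G - {{}}" using e left_face_in_faces by blast
next
  fix g assume "g \<in> (\<lambda>f. f - D) ` faces G - {{}}"
  then obtain f e where f: "f \<in> faces G" "g = f - D" "e \<in> f" "e \<notin> D" by blast
  then have "e \<in> E" "g = left_face G' e"
    using face_subset face_eq_left_face left_face_shrink by blast+
  then show "g \<in> faces G'" using f(4) by (auto simp: faces_def)
qed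

lemma bounded_face_Diff_nonempty: "f \<in> bounded_faces G \<Longrightarrow> f - D \<noteq> {}"
  using face_within_D_outer by (auto simp: bounded_faces_def)

lemma Diff_bounded_iff:
  assumes "f \<in> faces G" "f - D \<noteq> {}"
  shows "f - D \<in> bounded_faces G' \<longleftrightarrow> f \<in> bounded_faces G"
proof -
  have "f \<in> outer G" if "g \<in> outer G" "f - D = g - D" for g
    using face_Diff_eqD[OF assms(1) subsetD[OF outer_faces that(1)] that(2) assms(2)] that(1) by simp
  then have "f - D \<in> (\<lambda>f. f - D) ` outer G \<longleftrightarrow> f \<in> outer G"
    by (intro iffI imageI) (erule imageE, simp)
  then have "f - D \<in> outer G' \<longleftrightarrow> f \<in> outer G" using assms(2) by simp
  moreover have "f - D \<in> faces G'" unfolding faces_shrink using assms by blast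
  ultimately show ?thesis unfolding bounded_faces_def using assms(1) by blast
qed

lemma bij_betw_bounded_faces: "bij_betw (\<lambda>f. f - D) (bounded_faces G) (bounded_faces G')"
  unfolding bij_betw_def
proof
  show "inj_on (\<lambda>f. f - D) (bounded_faces G)"
  proof (rule inj_onI)
    fix f g assume fg: "f \<in> bounded_faces G" "g \<in> bounded_faces G" "f - D = g - D"
    then have "f \<in> faces G" "g \<in> faces G" by (simp_all add: bounded_faces_def)
    then show "f = g" by (rule face_Diff_eqD[OF _ _ fg(3) bounded_face_Diff_nonempty[OF fg(1)]])
  qed
  show "(\<lambda>f. f - D) ` bounded_faces G = bounded_faces G'"
  proof (intro equalityI subsetI)
    fix g assume "g \<in> (\<lambda>f. f - D) ` bounded_faces G"
    then obtain f where f: "f \<in> bounded_faces G" "g = f - D" by (rule imageE)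
    then have "f \<in> faces G" by (simp add: bounded_faces_def)
    from Diff_bounded_iff[OF this bounded_face_Diff_nonempty[OF f(1)]] f
    show "g \<in> bounded_faces G'" by (simp only:)
  next
    fix g assume g: "g \<in> bounded_faces G'"
    then have "g \<in> (\<lambda>f. f - D) ` faces G - {{}}"
      unfolding bounded_faces_def[of G'] faces_shrink by (rule DiffD1)
    then obtain f where f: "f \<in> faces G" "g = f - D" "f - D \<noteq> {}" by blast
    then have "f \<in> bounded_faces G" using Diff_bounded_iff[OF f(1,3)] g by (simp only:)
    with f(2) show "g \<in> (\<lambda>f. f - D) ` bounded_faces G" by (rule image_eqI)
  qed
qed

section \<open>Dimer configurations and heights under contraction\<close>

lemma neighbours_vertices: "x1 \<in> vertices" "x2 \<in> vertices" "x1 \<noteq> x" "x2 \<noteq> x"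
  and disjoint_neighbourhoods: "incident G x1 \<inter> incident G x2 = {}"
proof -
  have "x1 \<in> vertices \<and> x2 \<in> vertices \<and> x1 \<noteq> x \<and> x2 \<noteq> x \<and> incident G x1 \<inter> incident G x2 = {}"
  proof (cases rule: colour_cases)
    case white
    note ends = white_ends[OF white]
    have "x1 \<in> black G" "x2 \<in> black G" using ends(3,4) bend_black e1_in e2_in by simp_all
    moreover have "x \<notin> black G" using white colours_disjoint by blast
    ultimately show ?thesis using x1_neq_x2 by (auto simp: incident_black)
  next
    case black
    note ends = black_ends[OF black]
    have "x1 \<in> white G" "x2 \<in> white G" using ends(3,4) wend_white e1_in e2_in by simp_all
    moreover have "x \<notin> white G" using black colours_disjoint by blast
    ultimately show ?thesis using x1_neq_x2 by (auto simp: incident_white)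
  qed
  then show "x1 \<in> vertices" "x2 \<in> vertices" "x1 \<noteq> x" "x2 \<noteq> x"
    "incident G x1 \<inter> incident G x2 = {}" by simp_all
qed

lemma e1_incident: "e1 \<in> incident G v \<longleftrightarrow> v = x \<or> v = x1"
  and e2_incident: "e2 \<in> incident G v \<longleftrightarrow> v = x \<or> v = x2"
proof -
  have "(e1 \<in> incident G v \<longleftrightarrow> v = x \<or> v = x1) \<and> (e2 \<in> incident G v \<longleftrightarrow> v = x \<or> v = x2)"
  proof (cases rule: colour_cases)
    case white
    show ?thesis using white_ends[OF white] e1_in e2_in by (auto simp: incident_def)
  next
    case black
    show ?thesis using black_ends[OF black] e1_in e2_in by (auto simp: incident_def)
  qed
  then show "e1 \<in> incident G v \<longleftrightarrow> v = x \<or> v = x1" "e2 \<in> incident G v \<longleftrightarrow> v = x \<or> v = x2"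
    by simp_all
qed

lemma ends_neq_x: "e \<in> E \<Longrightarrow> e \<notin> D \<Longrightarrow> wend G e \<noteq> x \<and> bend G e \<noteq> x"
  using incident_x by (auto simp: incident_def)

text \<open>
  The vertex \<open>x1\<close> survives as the merged vertex and inherits the edges of both neighbours.
\<close>

lemma incident_shrink: "incident G' v =
  (if v \<in> {x, x2} then {} else if v = x1 then incident G x1 \<union> incident G x2 - D else incident G v)"
  (is "_ = ?R")
proof -
  have "e \<in> incident G' v \<longleftrightarrow> e \<in> ?R" for e
  proof (cases "e \<in> E \<and> e \<notin> D")
    case True
    then have "wend G e \<noteq> x" "bend G e \<noteq> x" using ends_neq_x by auto
    then show ?thesis using True x1_neq_x2 neighbours_vertices(3,4)
      by (auto simp: incident_def merge_def)
  next
    case False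
    then have "e \<notin> incident G' v" by (auto simp: incident_def)
    moreover have "e \<notin> ?R"
      using False e1_incident e2_incident by (auto simp: incident_def[of G])
    ultimately show ?thesis by simp
  qed
  then show ?thesis by blast
qed

lemma card_incident_x: "card (M \<inter> incident G x) = of_bool (e1 \<in> M) + of_bool (e2 \<in> M)"
  using e1_neq_e2 by (auto simp: incident_x Int_insert_right)

lemma card_incident_x1:
  "card (M \<inter> incident G x1) = card ((M - D) \<inter> incident G x1) + of_bool (e1 \<in> M)"
proof -
  have "e1 \<in> incident G x1" "e2 \<notin> incident G x1"
    using e1_incident e2_incident x1_neq_x2 neighbours_vertices by auto
  then have "M \<inter> incident G x1 = (if e1 \<in> M then insert e1 else id) ((M - D) \<inter> incident G x1)"
    by auto
  then show ?thesis using finite_incident by simp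
qed

lemma card_incident_x2:
  "card (M \<inter> incident G x2) = card ((M - D) \<inter> incident G x2) + of_bool (e2 \<in> M)"
proof -
  have "e2 \<in> incident G x2" "e1 \<notin> incident G x2"
    using e1_incident e2_incident x1_neq_x2 neighbours_vertices by auto
  then have "M \<inter> incident G x2 = (if e2 \<in> M then insert e2 else id) ((M - D) \<inter> incident G x2)"
    by auto
  then show ?thesis using finite_incident by simp
qed

lemma card_incident_merged:
  "card ((M - D) \<inter> incident G' x1) =
    card ((M - D) \<inter> incident G x1) + card ((M - D) \<inter> incident G x2)"
proof -
  have "(M - D) \<inter> incident G' x1 = ((M - D) \<inter> incident G x1) \<union> ((M - D) \<inter> incident G x2)"
    using x1_neq_x2 neighbours_vertices by (auto simp: incident_shrink)
  then show ?thesis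
    using card_Un_disjoint[of "(M - D) \<inter> incident G x1" "(M - D) \<inter> incident G x2"]
      disjoint_neighbourhoods finite_incident by auto
qed

lemma card_incident_other:
  assumes "v \<notin> {x, x1, x2}"
  shows "card ((M - D) \<inter> incident G' v) = card (M \<inter> incident G v)"
proof -
  have "(M - D) \<inter> incident G' v = M \<inter> incident G v"
    using assms e1_incident e2_incident by (auto simp: incident_shrink)
  then show ?thesis by simp
qed

abbreviation "covers_others M \<equiv>
  \<forall>v \<in> vertices - {x, x1, x2}. card (M \<inter> incident G v) = 1"

text \<open>
  The conditions at \<open>x\<close>, \<open>x1\<close> and \<open>x2\<close> say that the edges outside \<open>D\<close> cover exactly one of
  the two neighbours, and that \<open>x\<close> is matched with the other one.  Only the former survives
  contraction, in \<open>dimer_config_shrink_iff\<close>, as the condition at the merged vertex.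
\<close>

lemma dimer_config_iff:
  "dimer_config G M \<longleftrightarrow> M \<subseteq> E \<and> covers_others M \<and> (e1 \<in> M \<longleftrightarrow> e2 \<notin> M) \<and>
    card ((M - D) \<inter> incident G x1) = of_bool (e2 \<in> M) \<and>
    card ((M - D) \<inter> incident G x2) = of_bool (e1 \<in> M)"
proof -
  have "(\<forall>v \<in> vertices. card (M \<inter> incident G v) = 1) \<longleftrightarrow> covers_others M \<and>
    card (M \<inter> incident G x) = 1 \<and> card (M \<inter> incident G x1) = 1 \<and> card (M \<inter> incident G x2) = 1"
    using x_vertex neighbours_vertices(1,2) by blast
  moreover have "of_bool p + of_bool q = (1 :: nat) \<and> m + of_bool p = 1 \<and> n + of_bool q = 1 \<longleftrightarrow>
    (p \<longleftrightarrow> \<not> q) \<and> m = of_bool q \<and> n = of_bool p" for p q and m n :: nat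
    by (cases p; cases q) auto
  ultimately show ?thesis
    unfolding dimer_config_card card_incident_x card_incident_x1[of M] card_incident_x2[of M]
    by (simp only:)
qed

lemma dimer_config_shrink_iff:
  "dimer_config G' (M - D) \<longleftrightarrow> M - D \<subseteq> E \<and> covers_others M \<and>
    card ((M - D) \<inter> incident G x1) + card ((M - D) \<inter> incident G x2) = 1"
proof -
  have "white G' \<union> black G' = insert x1 (vertices - {x, x1, x2})"
    using x1_neq_x2 neighbours_vertices by auto
  then have "(\<forall>v \<in> white G' \<union> black G'. card ((M - D) \<inter> incident G' v) = 1) \<longleftrightarrow>
    covers_others M \<and> card ((M - D) \<inter> incident G' x1) = 1"
    using card_incident_other by auto
  moreover have "M - D \<subseteq> edges G' \<longleftrightarrow> M - D \<subseteq> E" by auto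
  ultimately show ?thesis unfolding dimer_config_card card_incident_merged by blast
qed

lemma bij_betw_dimer_configs:
  "bij_betw (\<lambda>M. M - D) {M. dimer_config G M} {M. dimer_config G' M}"
  unfolding bij_betw_def
proof
  show "inj_on (\<lambda>M. M - D) {M. dimer_config G M}"
  proof (rule inj_onI)
    fix M N assume "M \<in> {M. dimer_config G M}" "N \<in> {M. dimer_config G M}" and MN: "M - D = N - D"
    then have M: "dimer_config G M" and N: "dimer_config G N" by simp_all
    have "(of_bool (e2 \<in> M) :: nat) = of_bool (e2 \<in> N)" "(of_bool (e1 \<in> M) :: nat) = of_bool (e1 \<in> N)"
      using M N MN unfolding dimer_config_iff by metis+
    then have "e1 \<in> M \<longleftrightarrow> e1 \<in> N" "e2 \<in> M \<longleftrightarrow> e2 \<in> N" by (simp_all only: of_bool_eq_iff)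
    then show "M = N" using MN by blast
  qed
  show "(\<lambda>M. M - D) ` {M. dimer_config G M} = {M. dimer_config G' M}"
  proof (intro equalityI subsetI)
    fix N assume "N \<in> (\<lambda>M. M - D) ` {M. dimer_config G M}"
    then obtain M where "dimer_config G M" "N = M - D" by blast
    then show "N \<in> {M. dimer_config G' M}"
      unfolding mem_Collect_eq by (auto simp: dimer_config_iff dimer_config_shrink_iff)
  next
    fix N assume "N \<in> {M. dimer_config G' M}"
    then have N: "dimer_config G' N" by simp
    then have NE: "N \<subseteq> E" "N \<inter> D = {}" unfolding dimer_config_card by auto
    \<comment> \<open>the edge to add is the one towards the neighbour that \<open>N\<close> leaves uncovered\<close>
    define M where "M = (if card (N \<inter> incident G x1) = 0 then insert e1 N else insert e2 N)"
    have MD: "M - D = N" using NE by (auto simp: M_def)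
    have e12: "e1 \<in> M \<longleftrightarrow> card (N \<inter> incident G x1) = 0" "e2 \<in> M \<longleftrightarrow> card (N \<inter> incident G x1) \<noteq> 0"
      using NE e1_neq_e2 by (auto simp: M_def)
    have "M \<subseteq> E" using NE e1_in e2_in by (auto simp: M_def)
    moreover from N have "covers_others M"
      "card (N \<inter> incident G x1) + card (N \<inter> incident G x2) = 1"
      using dimer_config_shrink_iff[of M] unfolding MD by blast+
    ultimately have "dimer_config G M" unfolding dimer_config_iff MD e12 by auto
    then show "N \<in> (\<lambda>M. M - D) ` {M. dimer_config G M}" using MD by blast
  qed
qed

lemma sum_dimer_incident:
  assumes "dimer_config G M" "v \<in> vertices"
  shows "(\<Sum>e\<in>incident G v. of_bool (e \<in> M)) = (1 :: int)"
proof -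
  have "(\<Sum>e\<in>incident G v. of_bool (e \<in> M)) = int (card (M \<inter> incident G v))"
    using finite_incident by (simp add: Int_commute)
  then show ?thesis using assms by (simp add: dimer_config_card)
qed

text \<open>
  The contracted graph has no equations at \<open>e1\<close> and \<open>e2\<close>.  In \<open>G\<close> they are
  consequences of the remaining equations at \<open>x1\<close> and \<open>x2\<close>, since at each vertex the sum of
  all height equations holds automatically.
\<close>

lemma is_height_shrink_iff:
  assumes M: "dimer_config G M" and M1: "dimer_config G M1"
    and h: "\<And>f. f \<notin> bounded_faces G \<Longrightarrow> h f = 0"
    and h': "\<And>f. f \<notin> bounded_faces G' \<Longrightarrow> h' f = 0"
    and eq: "\<And>f. f \<in> bounded_faces G \<Longrightarrow> h' (f - D) = h f"
  shows "is_height G M1 M h \<longleftrightarrow> is_height G' (M1 - D) (M - D) h'"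
proof -
  let ?m = "\<lambda>e. of_bool (e \<in> M) - of_bool (e \<in> M1) :: int"
  let ?d = "\<lambda>e. h (left_face G e) - h (right_face G e)"
  have faces: "h' (f - D) = h f" if "f \<in> faces G" "f - D \<noteq> {}" for f
    using Diff_bounded_iff[OF that] eq h h' by metis
  have d': "h' (left_face G' e) - h' (right_face G' e) = ?d e" if e: "e \<in> E - D" for e
  proof -
    have "left_face G' e \<noteq> {}" "right_face G' e \<noteq> {}"
      by (simp_all only: right_face_def left_face_def orbit_nonempty not_False_eq_True)
    moreover have l: "left_face G' e = left_face G e - D" "right_face G' e = right_face G e - D"
      using e left_face_shrink right_face_shrink by simp_all
    ultimately have n: "left_face G e - D \<noteq> {}" "right_face G e - D \<noteq> {}" by (metis, metis)
    have "h' (left_face G' e) = h (left_face G e)"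
      unfolding l by (rule faces[OF left_face_in_faces n(1)]) (use e in simp)
    moreover have "h' (right_face G' e) = h (right_face G e)"
      unfolding l by (rule faces[OF right_face_in_faces n(2)]) (use e in simp)
    ultimately show ?thesis by (simp only:)
  qed
  \<comment> \<open>at each vertex, the equation at one edge follows from those at the others\<close>
  have at: "?m e = ?d e"
    if v: "v \<in> vertices" "e \<in> incident G v" and rest: "\<And>a. a \<in> incident G v - {e} \<Longrightarrow> ?m a = ?d a" for v e
  proof -
    have "(\<Sum>a\<in>incident G v. ?m a) = (\<Sum>a\<in>incident G v. ?d a)"
      using sum_dimer_incident[OF M v(1)] sum_dimer_incident[OF M1 v(1)]
        sum_left_face_eq_sum_right_face[OF v(1), of h] by (simp add: sum_subtractf)
    then show ?thesis by (rule eq_at_if_sum_eq[OF finite_incident v(2) _ rest])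
  qed
  have "(\<forall>e\<in>E. ?m e = ?d e) \<longleftrightarrow> (\<forall>e\<in>E - D. ?m e = ?d e)"
  proof (intro iffI ballI)
    fix e assume *: "\<forall>e\<in>E - D. ?m e = ?d e" and "e \<in> E"
    have "incident G x1 - {e1} \<subseteq> E - D" "incident G x2 - {e2} \<subseteq> E - D"
      using e1_incident[of x2] e2_incident[of x1] x1_neq_x2 neighbours_vertices(3,4)
      by (auto simp: incident_def)
    then have rest: "?m a = ?d a" if "a \<in> incident G x1 - {e1} \<or> a \<in> incident G x2 - {e2}" for a
      using * that by blast
    have "?m e1 = ?d e1"
      by (rule at[OF neighbours_vertices(1)]) (simp add: e1_incident, rule rest, simp)
    moreover have "?m e2 = ?d e2"
      by (rule at[OF neighbours_vertices(2)]) (simp add: e2_incident, rule rest, simp)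
    ultimately show "?m e = ?d e" using * \<open>e \<in> E\<close> by blast
  qed blast
  moreover have "(\<forall>e\<in>E - D. of_bool (e \<in> M - D) - of_bool (e \<in> M1 - D) =
      h' (left_face G' e) - h' (right_face G' e)) \<longleftrightarrow> (\<forall>e\<in>E - D. ?m e = ?d e)"
    using d' by auto
  ultimately show ?thesis
    unfolding is_height_def shrink_simps(3) using h h' by blast
qed

text \<open>
  Pulling functions back along \<open>f \<mapsto> f - D\<close> is a bijection between the height functions of
  the two graphs.  It therefore transports the unique height function when there is one, and the
  default value in the definition of \<open>height\<close> otherwise.
\<close>

lemma height_shrink:
  assumes M: "dimer_config G M" and M1: "dimer_config G M1" and f: "f \<in> bounded_faces G"
  shows "height G M1 M f = height G' (M1 - D) (M - D) (f - D)"
proof -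
  let ?H = "is_height G M1 M" and ?H' = "is_height G' (M1 - D) (M - D)"
  define U :: "('e set \<Rightarrow> int) \<Rightarrow> 'e set \<Rightarrow> int"
    where "U h' = (\<lambda>f. if f \<in> bounded_faces G then h' (f - D) else 0)" for h'
  have supp: "f \<notin> bounded_faces G \<Longrightarrow> h f = 0" if "?H h" for h f
    using that by (simp add: is_height_def)
  have supp': "f \<notin> bounded_faces G' \<Longrightarrow> h f = 0" if "?H' h" for h f
    using that unfolding is_height_def by blast
  have down: "?H (U h')" if "?H' h'" for h'
    using is_height_shrink_iff[OF M M1, of "U h'" h'] supp'[OF that] that by (simp add: U_def)
  have lift: "\<exists>h'. ?H' h' \<and> U h' = h" if h: "?H h" for h
  proof -
    let ?g = "inv_into (bounded_faces G) (\<lambda>f. f - D)"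
    define h' where "h' f' = (if f' \<in> bounded_faces G' then h (?g f') else 0)" for f'
    have eq: "h' (f - D) = h f" if "f \<in> bounded_faces G" for f
      using bij_betw_inv_into_left[OF bij_betw_bounded_faces that]
        bij_betw_apply[OF bij_betw_bounded_faces that] by (simp add: h'_def)
    have zero: "h' f' = 0" if "f' \<notin> bounded_faces G'" for f'
      unfolding h'_def using that by (rule if_not_P)
    have "?H' h'"
      by (rule iffD1[OF is_height_shrink_iff[OF M M1] h]) (fact supp[OF h] zero eq)+
    moreover have "U h' = h" using eq supp[OF h] by (auto simp: U_def)
    ultimately show ?thesis by blast
  qed
  have inj: "h' = k'" if hk: "?H' h'" "?H' k'" "U h' = U k'" for h' k'
  proof
    fix f'
    show "h' f' = k' f'"
    proof (cases "f' \<in> bounded_faces G'")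
      case True
      then obtain f where "f \<in> bounded_faces G" "f' = f - D"
        using bij_betw_bounded_faces unfolding bij_betw_def by blast
      then show ?thesis using fun_cong[OF hk(3), of f] by (simp add: U_def)
    next
      case False
      then show ?thesis using supp'[OF hk(1)] supp'[OF hk(2)] by simp
    qed
  qed
  show ?thesis
  proof (cases "\<exists>!h. ?H h")
    case True
    then obtain h where h: "?H h" "\<And>k. ?H k \<Longrightarrow> k = h" by blast
    obtain h' where h': "?H' h'" "U h' = h" using lift[OF h(1)] by blast
    have u': "k' = h'" if "?H' k'" for k'
      by (rule inj[OF that h'(1)]) (simp only: h(2)[OF down[OF that]] h'(2))
    have "height G M1 M = h"
      unfolding height_def if_P[OF True] using h by (rule the_equality)
    moreover have ex': "\<exists>!h'. ?H' h'" using h'(1) u' by (rule ex1I)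
    have "height G' (M1 - D) (M - D) = h'"
      unfolding height_def if_P[OF ex'] using h'(1) u' by (rule the_equality)
    moreover have "h f = h' (f - D)" using fun_cong[OF h'(2), of f] f by (simp add: U_def)
    ultimately show ?thesis by (simp only:)
  next
    case False
    have "\<not> (\<exists>!h'. ?H' h')"
    proof
      assume "\<exists>!h'. ?H' h'"
      then obtain h' where h': "?H' h'" "\<And>k'. ?H' k' \<Longrightarrow> k' = h'" by (rule ex1E) blast
      have "k = U h'" if "?H k" for k
        using lift[OF that] by (elim exE conjE) (drule h'(2), simp only:)
      with down[OF h'(1)] have "\<exists>!h. ?H h" by (rule ex1I)
      with False show False by (rule notE)
    qed
    with False show ?thesis by (simp only: height_def if_False)
  qed
qed

lemma face_partition_shrink:
  assumes M1: "dimer_config G M1"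
    and weights: "\<And>f. f \<in> bounded_faces G \<Longrightarrow> face_weight G \<kappa> f = face_weight G' \<kappa> (f - D)"
  shows "face_partition G \<kappa> M1 = face_partition G' \<kappa> (M1 - D)"
proof -
  let ?w = "\<lambda>M f. face_weight G' \<kappa> f powi height G' (M1 - D) M f"
  have "face_partition G' \<kappa> (M1 - D) =
      (\<Sum>M | dimer_config G M. \<Prod>f\<in>bounded_faces G'. ?w (M - D) f)"
    unfolding face_partition_def
    by (rule sum.reindex_bij_betw[OF bij_betw_dimer_configs, symmetric])
  also have "\<dots> = (\<Sum>M | dimer_config G M. \<Prod>f\<in>bounded_faces G. ?w (M - D) (f - D))"
    by (simp only: prod.reindex_bij_betw[OF bij_betw_bounded_faces, symmetric])
  also have "\<dots> = face_partition G \<kappa> M1"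
    unfolding face_partition_def
    by (intro sum.cong prod.cong) (simp_all add: weights height_shrink[OF _ M1])
  finally show ?thesis by simp
qed

section \<open>Face weights under contraction\<close>

lemma left_face_shrink_self: "e \<notin> D \<Longrightarrow> e \<in> left_face G' e"
  using left_face_shrink left_face_self by blast

lemma bij_betw_face: "f \<in> faces G \<Longrightarrow> bij_betw (rb \<circ> rw) f f"
  unfolding faces_def left_face_def
  using bij_betw_orbit[OF permutation_self_in_orbit[OF face_permutation]] by blast

lemma bij_betw_face_shrink:
  assumes "f \<in> faces G"
  shows "bij_betw (rot_black G' \<circ> rot_white G') (f - D) (f - D)"
proof (cases "f - D = {}")
  case True
  show ?thesis unfolding True by (simp add: bij_betw_def)
next
  case False
  then obtain e where e: "e \<in> f" "e \<notin> D" by blast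
  then have "f - D = left_face G' e"
    using face_eq_left_face[OF assms] left_face_shrink by simp
  moreover have "bij_betw (rot_black G' \<circ> rot_white G') (left_face G' e) (left_face G' e)"
    using left_face_shrink_self[OF e(2)] unfolding left_face_def by (rule bij_betw_orbit)
  ultimately show ?thesis by simp
qed

text \<open>
  In the weight of a face the rotation of the colour of \<open>x\<close> is the convenient one, as it
  exchanges \<open>e1\<close> and \<open>e2\<close> and is not affected by splicing.  For black \<open>x\<close> this is
  \<open>inv rb\<close> in place of \<open>rw\<close>: since \<open>rw e = inv rb ((rb \<circ> rw) e)\<close> and the face
  permutation permutes \<open>f\<close>, the denominators \<open>\<kappa> (rw e)\<close> and \<open>\<kappa> (inv rb e)\<close> are the same up
  to their order.
\<close>

lemma weight_denominators:
  assumes "f \<in> faces G"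
  obtains \<tau> where "\<tau> e1 = e2" "\<tau> e2 = e1"
    "(\<Prod>e\<in>f. \<kappa> (rw e)) = (\<Prod>e\<in>f. \<kappa> (\<tau> e) :: complex)"
    "(\<Prod>e\<in>f - D. \<kappa> (rot_white G' e)) = (\<Prod>e\<in>f - D. \<kappa> (\<tau> e))"
proof (cases rule: colour_cases)
  case white
  have "(\<Prod>e\<in>f - D. \<kappa> (rot_white G' e)) = (\<Prod>e\<in>f - D. \<kappa> (rw e))"
    by (rule prod.cong) (simp_all add: splice_rw_white[OF white])
  with white_rot(1,2)[OF white] show thesis by (intro that[of rw]) simp_all
next
  case black
  have inv: "inv rb (rb e) = e" for e by (rule inv_f_f[OF permutes_inj[OF rb_permutes]])
  have "inv rb e1 = e2" "inv rb e2 = e1"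
    using inv[of e1] inv[of e2] black_rot(1,2)[OF black] by simp_all
  moreover have "(\<Prod>e\<in>f. \<kappa> (rw e)) = (\<Prod>e\<in>f. \<kappa> (inv rb e))"
    using prod.reindex_bij_betw[OF bij_betw_face[OF assms], of "\<lambda>e. \<kappa> (inv rb e)"] by (simp add: inv)
  moreover have "(\<Prod>e\<in>f - D. \<kappa> (rot_white G' e)) = (\<Prod>e\<in>f - D. \<kappa> (inv rb e))"
  proof -
    have "(\<Prod>e\<in>f - D. \<kappa> (rot_white G' e)) =
        (\<Prod>e\<in>f - D. \<kappa> (inv rb ((rot_black G' \<circ> rot_white G') e)))"
      by (rule prod.cong)
        (simp_all add: splice_rb_black[OF black splice_rw_black_notin[OF black]] inv)
    also have "\<dots> = (\<Prod>e\<in>f - D. \<kappa> (inv rb e))"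
      by (rule prod.reindex_bij_betw[OF bij_betw_face_shrink[OF assms]])
    finally show ?thesis .
  qed
  ultimately show thesis by (rule that)
qed

text \<open>
  Each contracted edge on \<open>f\<close> removes one factor from the product and one from the exponent of
  \<open>-1\<close>, which accounts for the minus sign.
\<close>

lemma face_weight_shrink:
  assumes f: "f \<in> faces G"
  shows "face_weight G \<kappa> f =
    (\<Prod>e\<in>f \<inter> D. - \<kappa> e / \<kappa> (if e = e1 then e2 else e1)) * face_weight G' \<kappa> (f - D)"
proof -
  have fin: "finite f" using face_subset[OF f] finite_edges by (rule finite_subset)
  obtain \<tau> where \<tau>: "\<tau> e1 = e2" "\<tau> e2 = e1"
    "(\<Prod>e\<in>f. \<kappa> (rw e)) = (\<Prod>e\<in>f. \<kappa> (\<tau> e))"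
    "(\<Prod>e\<in>f - D. \<kappa> (rot_white G' e)) = (\<Prod>e\<in>f - D. \<kappa> (\<tau> e))"
    using weight_denominators[OF f, of \<kappa>] by blast
  have split: "f = (f \<inter> D) \<union> (f - D)" "(f \<inter> D) \<inter> (f - D) = {}" by blast+
  have "card f = card (f \<inter> D) + card (f - D)"
    using card_Un_disjoint[OF _ _ split(2)] fin split(1) by simp
  moreover have "(\<Prod>e\<in>f. \<kappa> e / \<kappa> (\<tau> e)) =
      (\<Prod>e\<in>f \<inter> D. \<kappa> e / \<kappa> (\<tau> e)) * (\<Prod>e\<in>f - D. \<kappa> e / \<kappa> (\<tau> e))"
    using prod.union_disjoint[OF _ _ split(2)] fin split(1) by simp
  ultimately have "face_weight G \<kappa> f = ((-1) ^ card (f \<inter> D) * (\<Prod>e\<in>f \<inter> D. \<kappa> e / \<kappa> (\<tau> e))) *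
      ((-1) ^ (card (f - D) + 1) * (\<Prod>e\<in>f - D. \<kappa> e / \<kappa> (\<tau> e)))"
    using \<tau>(3) by (simp add: face_weight_def prod_dividef power_add)
  also have "(-1) ^ (card (f - D) + 1) * (\<Prod>e\<in>f - D. \<kappa> e / \<kappa> (\<tau> e)) = face_weight G' \<kappa> (f - D)"
    using \<tau>(4) by (simp add: face_weight_def prod_dividef)
  also have "(-1) ^ card (f \<inter> D) * (\<Prod>e\<in>f \<inter> D. \<kappa> e / \<kappa> (\<tau> e)) =
      (\<Prod>e\<in>f \<inter> D. - (\<kappa> e / \<kappa> (\<tau> e)))"
    by (rule prod_uminus[symmetric])
  also have "\<dots> = (\<Prod>e\<in>f \<inter> D. - \<kappa> e / \<kappa> (if e = e1 then e2 else e1))"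
    using \<tau>(1,2) by (intro prod.cong) auto
  finally show ?thesis .
qed

lemma face_weight_shrink_eq:
  assumes "\<kappa> e1 + \<kappa> e2 = 0" "\<kappa> e1 \<noteq> 0" "f \<in> faces G"
  shows "face_weight G \<kappa> f = face_weight G' \<kappa> (f - D)"
proof -
  have "\<kappa> e1 = - \<kappa> e2" using assms(1) by (simp add: eq_neg_iff_add_eq_0)
  then have "(\<Prod>e\<in>f \<inter> D. - \<kappa> e / \<kappa> (if e = e1 then e2 else e1)) = 1"
    using assms(2) by (intro prod.neutral) auto
  then show ?thesis using face_weight_shrink[OF assms(3), of \<kappa>] by simp
qed

text \<open>
  With only one contracted edge on \<open>f\<close>, the two weights differ by the single factor
  \<open>- \<kappa> e1 / \<kappa> e2\<close> or its inverse.
\<close>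

lemma sum_zero_if_face_weight_eq:
  assumes nz: "\<And>e. e \<in> E \<Longrightarrow> \<kappa> e \<noteq> 0" and f: "f \<in> faces G"
    and one_side: "f \<inter> D = {e1} \<or> f \<inter> D = {e2}"
    and eq: "face_weight G \<kappa> f = face_weight G' \<kappa> (f - D)"
  shows "\<kappa> e1 + \<kappa> e2 = 0"
proof -
  have "\<kappa> e / \<kappa> (rw e) \<noteq> 0" if "e \<in> f" for e
    using nz[of e] nz[of "rw e"] face_subset[OF f] that by auto
  then have "(\<Prod>e\<in>f. \<kappa> e / \<kappa> (rw e)) \<noteq> 0"
    using finite_subset[OF face_subset[OF f] finite_edges] by (simp add: prod_zero_iff)
  then have "face_weight G \<kappa> f \<noteq> 0" by (simp add: face_weight_def)
  then have one: "(\<Prod>e\<in>f \<inter> D. - \<kappa> e / \<kappa> (if e = e1 then e2 else e1)) = 1"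
    using face_weight_shrink[OF f, of \<kappa>] eq by simp
  from one_side have "- \<kappa> e1 = \<kappa> e2 \<or> - \<kappa> e2 = \<kappa> e1"
  proof
    assume "f \<inter> D = {e1}"
    with one have "- \<kappa> e1 / \<kappa> e2 = 1" by simp
    then show ?thesis using right_inverse_eq[OF nz[OF e2_in]] by blast
  next
    assume "f \<inter> D = {e2}"
    with one have "- \<kappa> e2 / \<kappa> e1 = 1" using e1_neq_e2 by simp
    then show ?thesis using right_inverse_eq[OF nz[OF e1_in]] by blast
  qed
  then show ?thesis by (metis add.left_inverse add.right_inverse)
qed

lemma bounded_face_on_one_side:
  assumes "left_face G e1 \<noteq> right_face G e1"
  obtains f where "f \<in> bounded_faces G" "f \<inter> D = {e1} \<or> f \<inter> D = {e2}"
proof -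
  have ne: "left_face G e1 \<noteq> left_face G e2" using assms by (simp add: right_face_e1)
  then have "e2 \<notin> left_face G e1" "e1 \<notin> left_face G e2" using left_face_eqI by metis+
  then have "left_face G e1 \<inter> D = {e1}" "left_face G e2 \<inter> D = {e2}"
    using left_face_self[of e1] left_face_self[of e2] by auto
  moreover have "left_face G e1 \<in> bounded_faces G \<or> left_face G e2 \<in> bounded_faces G"
    using outer_sides_eq[OF e1_in] assms left_face_in_faces[OF e1_in] left_face_in_faces[OF e2_in]
    by (auto simp: bounded_faces_def right_face_e1)
  ultimately show thesis using that by blast
qed

section \<open>The kernel of the Kasteleyn operator under contraction\<close>

text \<open>
  The value of the Kasteleyn operator at the white vertex \<open>w\<close>, restricted to the edges in
  \<open>A\<close>.
\<close>

abbreviation "row \<kappa> A w f \<equiv> \<Sum>e \<in> {e \<in> A. wend G e = w}. \<kappa> e * f (bend G e) :: complex"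

lemma kast_ker_G: "f \<in> kast_ker G \<kappa> \<longleftrightarrow>
  (\<forall>v. v \<notin> black G \<longrightarrow> f v = 0) \<and> (\<forall>w \<in> white G. row \<kappa> E w f = 0)"
  by (rule kast_ker_iff) (use finite_edges finite_black bend_black in auto)

lemma merge_outside: "v \<notin> {x, x2} \<Longrightarrow> merge G x e1 e2 v = v"
  by (simp add: merge_def)

lemma kast_ker_shrink: "g \<in> kast_ker G' \<kappa> \<longleftrightarrow>
  (\<forall>v. v \<notin> black G' \<longrightarrow> g v = 0) \<and>
  (\<forall>w \<in> white G'. (\<Sum>e \<in> {e \<in> E - D. merge G x e1 e2 (wend G e) = w}.
     \<kappa> e * g (merge G x e1 e2 (bend G e))) = 0)"
proof -
  have "bend G' ` edges G' \<subseteq> black G'"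
  proof (rule image_subsetI)
    fix e assume "e \<in> edges G'"
    then have e: "e \<in> E" "e \<notin> D" by auto
    show "bend G' e \<in> black G'"
    proof (cases rule: colour_cases)
      case white
      then have "x1 \<in> black G" using white_ends(3) bend_black e1_in by simp
      then show ?thesis
        using bend_black[OF e(1)] neighbours_vertices(3) x1_neq_x2 by (auto simp: merge_def)
    next
      case black
      then have "x2 \<in> white G" using black_ends(4) wend_white e2_in by simp
      then show ?thesis
        using bend_black[OF e(1)] bend_not_white[OF e(1)] ends_neq_x[OF e]
        by (auto simp: merge_def)
    qed
  qed
  from kast_ker_iff[OF _ _ this, of g \<kappa>] show ?thesis using finite_edges finite_black by simp
qed

text \<open>
  At \<open>x\<close> the kernel equation is \<open>\<kappa> e1 * (f x1 - f x2) = 0\<close>, so \<open>f\<close> is constant on the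
  merged vertices.  The isomorphism forgets the value at \<open>x2\<close>, and its inverse pulls back along
  \<open>merge\<close>.
\<close>

lemma kernel_iso_white:
  assumes "x \<in> white G" and opp: "\<kappa> e1 + \<kappa> e2 = 0" and "\<kappa> e1 \<noteq> 0"
  shows "\<exists>\<Phi>. linear_iso (kast_ker G \<kappa>) (kast_ker G' \<kappa>) \<Phi> \<and>
    (\<forall>f \<in> kast_ker G \<kappa>. \<forall>b \<in> black G - {x}. \<Phi> f (merge G x e1 e2 b) = f b)"
proof -
  let ?m = "merge G x e1 e2"
  define \<Phi> :: "('v \<Rightarrow> complex) \<Rightarrow> 'v \<Rightarrow> complex" where "\<Phi> f = (\<lambda>v. if v = x2 then 0 else f v)" for f
  define \<Psi> :: "('v \<Rightarrow> complex) \<Rightarrow> 'v \<Rightarrow> complex" where "\<Psi> g = (\<lambda>v. if v \<in> black G then g (?m v) else 0)" for g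
  note ends = white_ends[OF assms(1)]
  have x1_black: "x1 \<in> black G" and x2_black: "x2 \<in> black G"
    using ends(3,4) bend_black e1_in e2_in by simp_all
  have x_not_black: "x \<notin> black G" and x2_not_white: "x2 \<notin> white G"
    using assms(1) x2_black colours_disjoint by blast+
  have star_x: "{e \<in> E. wend G e = x} = D"
    using incident_white[OF assms(1)] incident_x by simp
  have row_x: "row \<kappa> E x f = \<kappa> e1 * (f x1 - f x2)" for f
  proof -
    have "\<kappa> e2 = - \<kappa> e1" using opp by (simp add: add_eq_0_iff)
    then show ?thesis
      unfolding star_x using e1_neq_e2 by (simp add: ends(3,4)[symmetric] right_diff_distrib)
  qed
  have star: "{e \<in> E - D. ?m (wend G e) = w} = {e \<in> E. wend G e = w}" if "w \<in> white G - {x}" for w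
  proof -
    have "?m (wend G e) = wend G e" if "e \<in> E - D" for e
      using that ends_neq_x[of e] wend_white[of e] x2_not_white by (intro merge_outside) auto
    moreover have "wend G e \<noteq> w" if "e \<in> D" for e
      using that \<open>w \<in> white G - {x}\<close> ends(1,2) by auto
    ultimately show ?thesis by auto
  qed
  have ker: "f \<in> kast_ker G \<kappa> \<longleftrightarrow> (\<forall>v. v \<notin> black G \<longrightarrow> f v = 0) \<and> f x1 = f x2 \<and>
      (\<forall>w \<in> white G - {x}. row \<kappa> E w f = 0)" for f
  proof -
    have "(\<forall>w \<in> white G. row \<kappa> E w f = 0) \<longleftrightarrow>
        row \<kappa> E x f = 0 \<and> (\<forall>w \<in> white G - {x}. row \<kappa> E w f = 0)"
      using assms(1) by blast
    then show ?thesis using assms(3) unfolding kast_ker_G row_x by simp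
  qed
  have ker': "g \<in> kast_ker G' \<kappa> \<longleftrightarrow> (\<forall>v. v \<notin> black G - {x2} \<longrightarrow> g v = 0) \<and>
      (\<forall>w \<in> white G - {x}. row \<kappa> E w (\<lambda>v. g (?m v)) = 0)" for g
  proof -
    have "white G' = white G - {x}" "black G' = black G - {x2}"
      using x2_not_white x_not_black by auto
    then show ?thesis unfolding kast_ker_shrink using star by simp
  qed
  have m_black: "?m v = (if v = x2 then x1 else v)" if "v \<in> black G" for v
    using that x_not_black by (auto simp: merge_def)
  have \<Phi>_m: "\<Phi> f (?m v) = f v" if "f x1 = f x2" "v \<in> black G" for f v
    using that x1_neq_x2 by (simp add: \<Phi>_def m_black)
  have row_cong: "row \<kappa> E w f = row \<kappa> E w g" if "\<And>v. v \<in> black G \<Longrightarrow> f v = g v" for f g w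
    using that bend_black by (intro sum.cong) auto
  have "bij_betw \<Phi> (kast_ker G \<kappa>) (kast_ker G' \<kappa>)"
  proof (rule bij_betw_byWitness[where f' = \<Psi>])
    show "\<forall>f\<in>kast_ker G \<kappa>. \<Psi> (\<Phi> f) = f"
      by (auto simp: ker fun_eq_iff \<Psi>_def \<Phi>_m)
    show "\<forall>g\<in>kast_ker G' \<kappa>. \<Phi> (\<Psi> g) = g"
      by (auto simp: ker' fun_eq_iff \<Phi>_def \<Psi>_def m_black)
    show "\<Phi> ` kast_ker G \<kappa> \<subseteq> kast_ker G' \<kappa>"
    proof (rule image_subsetI)
      fix f assume f: "f \<in> kast_ker G \<kappa>"
      then have "row \<kappa> E w (\<lambda>v. \<Phi> f (?m v)) = row \<kappa> E w f" for w
        by (intro row_cong \<Phi>_m) (simp_all add: ker)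
      with f show "\<Phi> f \<in> kast_ker G' \<kappa>" unfolding ker ker' by (simp add: \<Phi>_def)
    qed
    show "\<Psi> ` kast_ker G' \<kappa> \<subseteq> kast_ker G \<kappa>"
    proof (rule image_subsetI)
      fix g assume g: "g \<in> kast_ker G' \<kappa>"
      have "row \<kappa> E w (\<Psi> g) = row \<kappa> E w (\<lambda>v. g (?m v))" for w
        by (rule row_cong) (simp add: \<Psi>_def)
      with g show "\<Psi> g \<in> kast_ker G \<kappa>" unfolding ker ker'
        using x1_black x2_black x1_neq_x2 by (simp add: \<Psi>_def m_black)
    qed
  qed
  then have "linear_iso (kast_ker G \<kappa>) (kast_ker G' \<kappa>) \<Phi>"
    by (auto simp: linear_iso_def \<Phi>_def)
  moreover have "\<forall>f \<in> kast_ker G \<kappa>. \<forall>b \<in> black G - {x}. \<Phi> f (?m b) = f b"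
    using \<Phi>_m by (auto simp: ker)
  ultimately show ?thesis by blast
qed

text \<open>
  The value \<open>f x\<close> enters only the equations at \<open>x1\<close> and \<open>x2\<close>, with coefficients
  \<open>\<kappa> e1\<close> and \<open>- \<kappa> e1\<close>.  Their sum is the equation at the merged vertex.  The isomorphism
  forgets \<open>f x\<close>, and its inverse solves the equation at \<open>x1\<close> for it; the equation at \<open>x2\<close> then
  follows from the one at the merged vertex.
\<close>

lemma kernel_iso_black:
  assumes "x \<in> black G" and opp: "\<kappa> e1 + \<kappa> e2 = 0" and "\<kappa> e1 \<noteq> 0"
  shows "\<exists>\<Phi>. linear_iso (kast_ker G \<kappa>) (kast_ker G' \<kappa>) \<Phi> \<and>
    (\<forall>f \<in> kast_ker G \<kappa>. \<forall>b \<in> black G - {x}. \<Phi> f (merge G x e1 e2 b) = f b)"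
proof -
  let ?m = "merge G x e1 e2"
  let ?S = "row \<kappa> (E - D)"
  define \<Phi> :: "('v \<Rightarrow> complex) \<Rightarrow> 'v \<Rightarrow> complex" where "\<Phi> f = f(x := 0)" for f
  define \<Psi> :: "('v \<Rightarrow> complex) \<Rightarrow> 'v \<Rightarrow> complex" where "\<Psi> g = g(x := - ?S x1 g / \<kappa> e1)" for g
  note ends = black_ends[OF assms(1)]
  have \<kappa>2: "\<kappa> e2 = - \<kappa> e1" using opp by (simp add: add_eq_0_iff)
  have x1_white: "x1 \<in> white G" and x2_white: "x2 \<in> white G"
    using ends(3,4) wend_white e1_in e2_in by simp_all
  have x_not_white: "x \<notin> white G" and x2_not_black: "x2 \<notin> black G"
    using assms(1) x2_white colours_disjoint by blast+
  have fin: "finite {e \<in> E - D. P e}" for P using finite_edges by simp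
  have row_x1: "row \<kappa> E x1 f = \<kappa> e1 * f x + ?S x1 f" for f
  proof -
    have "{e \<in> E. wend G e = x1} = insert e1 {e \<in> E - D. wend G e = x1}"
      using e1_in ends(3,4) x1_neq_x2 by auto
    then show ?thesis using fin by (simp add: ends(1))
  qed
  have row_x2: "row \<kappa> E x2 f = - \<kappa> e1 * f x + ?S x2 f" for f
  proof -
    have "{e \<in> E. wend G e = x2} = insert e2 {e \<in> E - D. wend G e = x2}"
      using e2_in ends(3,4) x1_neq_x2 by auto
    then show ?thesis using fin by (simp add: ends(2) \<kappa>2)
  qed
  have row_other: "row \<kappa> E w f = ?S w f" if "w \<notin> {x1, x2}" for w f
  proof -
    have "{e \<in> E. wend G e = w} = {e \<in> E - D. wend G e = w}"
      using that ends(3,4) by auto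
    then show ?thesis by simp
  qed
  have S_upd: "?S w (f(x := c)) = ?S w f" for w f c
    using ends_neq_x by (intro sum.cong) auto
  have ker: "f \<in> kast_ker G \<kappa> \<longleftrightarrow> (\<forall>v. v \<notin> black G \<longrightarrow> f v = 0) \<and>
      (\<forall>w \<in> white G - {x1, x2}. ?S w f = 0) \<and>
      \<kappa> e1 * f x + ?S x1 f = 0 \<and> - \<kappa> e1 * f x + ?S x2 f = 0" for f
  proof -
    have "(\<forall>w \<in> white G. row \<kappa> E w f = 0) \<longleftrightarrow>
        (\<forall>w \<in> white G - {x1, x2}. row \<kappa> E w f = 0) \<and> row \<kappa> E x1 f = 0 \<and> row \<kappa> E x2 f = 0"
      using x1_white x2_white by blast
    moreover have "(\<forall>w \<in> white G - {x1, x2}. row \<kappa> E w f = 0) \<longleftrightarrow>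
        (\<forall>w \<in> white G - {x1, x2}. ?S w f = 0)"
      by (rule ball_cong[OF refl]) (simp add: row_other)
    ultimately show ?thesis unfolding kast_ker_G row_x1 row_x2 by blast
  qed
  have m_bend: "?m (bend G e) = bend G e" if "e \<in> E - D" for e
    using that ends_neq_x[of e] bend_black[of e] x2_not_black by (intro merge_outside) auto
  have row': "(\<Sum>e \<in> {e \<in> E - D. ?m (wend G e) = w}. \<kappa> e * g (?m (bend G e))) =
      (if w = x1 then ?S x1 g + ?S x2 g else ?S w g)" if "w \<in> white G - {x2}" for w g
  proof -
    have "(\<Sum>e \<in> {e \<in> E - D. ?m (wend G e) = w}. \<kappa> e * g (?m (bend G e))) =
        (\<Sum>e \<in> {e \<in> E - D. ?m (wend G e) = w}. \<kappa> e * g (bend G e))"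
      by (rule sum.cong) (simp_all add: m_bend)
    also have "\<dots> = (if w = x1 then ?S x1 g + ?S x2 g else ?S w g)"
    proof (cases "w = x1")
      case True
      have split: "{e \<in> E - D. ?m (wend G e) = w} =
          {e \<in> E - D. wend G e = x1} \<union> {e \<in> E - D. wend G e = x2}"
        using True ends_neq_x x1_neq_x2 neighbours_vertices(3) by (auto simp: merge_def)
      have "{e \<in> E - D. wend G e = x1} \<inter> {e \<in> E - D. wend G e = x2} = {}"
        using x1_neq_x2 by auto
      then show ?thesis unfolding split if_P[OF True] by (rule sum.union_disjoint[OF fin fin])
    next
      case False
      have "{e \<in> E - D. ?m (wend G e) = w} = {e \<in> E - D. wend G e = w}"
        using False ends_neq_x \<open>w \<in> white G - {x2}\<close> by (auto simp: merge_def)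
      then show ?thesis using False by (simp only: if_False)
    qed
    finally show ?thesis .
  qed
  have ker': "g \<in> kast_ker G' \<kappa> \<longleftrightarrow> (\<forall>v. v \<notin> black G - {x} \<longrightarrow> g v = 0) \<and>
      (\<forall>w \<in> white G - {x1, x2}. ?S w g = 0) \<and> ?S x1 g + ?S x2 g = 0" for g
  proof -
    have c: "white G' = white G - {x2}" "black G' = black G - {x}"
      using x_not_white x2_not_black by auto
    have "(\<forall>w \<in> white G - {x2}. (if w = x1 then ?S x1 g + ?S x2 g else ?S w g) = 0) \<longleftrightarrow>
        (\<forall>w \<in> white G - {x1, x2}. ?S w g = 0) \<and> ?S x1 g + ?S x2 g = 0"
      using x1_white x1_neq_x2 by auto
    moreover have "(\<forall>w \<in> white G - {x2}.
        (\<Sum>e \<in> {e \<in> E - D. ?m (wend G e) = w}. \<kappa> e * g (?m (bend G e))) = 0) \<longleftrightarrow>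
        (\<forall>w \<in> white G - {x2}. (if w = x1 then ?S x1 g + ?S x2 g else ?S w g) = 0)"
      by (rule ball_cong[OF refl]) (simp only: row')
    ultimately show ?thesis unfolding kast_ker_shrink c by blast
  qed
  have "bij_betw \<Phi> (kast_ker G \<kappa>) (kast_ker G' \<kappa>)"
  proof (rule bij_betw_byWitness[where f' = \<Psi>])
    show "\<forall>f\<in>kast_ker G \<kappa>. \<Psi> (\<Phi> f) = f"
    proof
      fix f assume "f \<in> kast_ker G \<kappa>"
      then have "?S x1 f = - (\<kappa> e1 * f x)" unfolding ker by (simp add: eq_neg_iff_add_eq_0 add.commute)
      then have "- ?S x1 f / \<kappa> e1 = f x" using assms(3) by simp
      then show "\<Psi> (\<Phi> f) = f" unfolding \<Psi>_def \<Phi>_def S_upd by simp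
    qed
    show "\<forall>g\<in>kast_ker G' \<kappa>. \<Phi> (\<Psi> g) = g"
      by (auto simp: ker' \<Phi>_def \<Psi>_def fun_eq_iff)
    show "\<Phi> ` kast_ker G \<kappa> \<subseteq> kast_ker G' \<kappa>"
    proof (rule image_subsetI)
      fix f assume f: "f \<in> kast_ker G \<kappa>"
      have "?S x1 f + ?S x2 f = (\<kappa> e1 * f x + ?S x1 f) + (- \<kappa> e1 * f x + ?S x2 f)" by simp
      also have "\<dots> = 0" using f unfolding ker by simp
      finally show "\<Phi> f \<in> kast_ker G' \<kappa>"
        using f unfolding ker ker' \<Phi>_def S_upd by simp
    qed
    show "\<Psi> ` kast_ker G' \<kappa> \<subseteq> kast_ker G \<kappa>"
    proof (rule image_subsetI)
      fix g assume g: "g \<in> kast_ker G' \<kappa>"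
      have "\<kappa> e1 * (- ?S x1 g / \<kappa> e1) = - ?S x1 g" using assms(3) by simp
      then show "\<Psi> g \<in> kast_ker G \<kappa>"
        using g assms(1) unfolding ker ker' \<Psi>_def S_upd by auto
    qed
  qed
  then have "linear_iso (kast_ker G \<kappa>) (kast_ker G' \<kappa>) \<Phi>"
    by (auto simp: linear_iso_def \<Phi>_def fun_eq_iff)
  moreover have "\<Phi> f (?m b) = f b" if "b \<in> black G - {x}" for f b
  proof -
    have "b \<notin> {x, x2}" using that x2_not_black by blast
    then show ?thesis by (simp add: \<Phi>_def merge_outside)
  qed
  ultimately show ?thesis by blast
qed

section \<open>The sum condition at a 2-valent vertex\<close>

text \<open>
  The neighbours of \<open>x\<close> are distinct, so no parallel edges add up in the coefficients at
  \<open>x\<close>.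
\<close>

lemma kast_white:
  assumes "x \<in> white G"
  shows "kast G \<kappa> x (bend G e1) = \<kappa> e1" "kast G \<kappa> x (bend G e2) = \<kappa> e2"
proof -
  have "{e \<in> E. wend G e = x} = D" using incident_white[OF assms] incident_x by simp
  then have "{e \<in> E. wend G e = x \<and> bend G e = b} = {e \<in> D. bend G e = b}" for b by blast
  moreover have "{e \<in> D. bend G e = bend G e1} = {e1}" "{e \<in> D. bend G e = bend G e2} = {e2}"
    using white_ends(5)[OF assms] by auto
  ultimately show "kast G \<kappa> x (bend G e1) = \<kappa> e1" "kast G \<kappa> x (bend G e2) = \<kappa> e2"
    by (simp_all add: kast_def)
qed

lemma kast_black:
  assumes "x \<in> black G"
  shows "kast G \<kappa> (wend G e1) x = \<kappa> e1" "kast G \<kappa> (wend G e2) x = \<kappa> e2"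
proof -
  have "{e \<in> E. bend G e = x} = D" using incident_black[OF assms] incident_x by simp
  then have "{e \<in> E. wend G e = w \<and> bend G e = x} = {e \<in> D. wend G e = w}" for w by blast
  moreover have "{e \<in> D. wend G e = wend G e1} = {e1}" "{e \<in> D. wend G e = wend G e2} = {e2}"
    using black_ends(5)[OF assms] by auto
  ultimately show "kast G \<kappa> (wend G e1) x = \<kappa> e1" "kast G \<kappa> (wend G e2) x = \<kappa> e2"
    by (simp_all add: kast_def)
qed

lemma sum_zero_at_x:
  assumes "two_valent_sum_zero G \<kappa>"
  shows "\<kappa> e1 + \<kappa> e2 = 0"
proof -
  have card: "card (incident G x) = 2" using e1_neq_e2 by (simp add: incident_x)
  show ?thesis
  proof (cases rule: colour_cases)
    case white
    then have "kast G \<kappa> x (bend G e1) + kast G \<kappa> x (bend G e2) = 0"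
      using assms card white_ends(5) unfolding two_valent_sum_zero_def
      by (metis image_insert image_empty incident_x)
    then show ?thesis by (simp add: kast_white[OF white])
  next
    case black
    then have "kast G \<kappa> (wend G e1) x + kast G \<kappa> (wend G e2) x = 0"
      using assms card black_ends(5) unfolding two_valent_sum_zero_def
      by (metis image_insert image_empty incident_x)
    then show ?thesis by (simp add: kast_black[OF black])
  qed
qed

end

context plane_graph
begin

lemma shrink_moveI: "two_valent G x e1 e2 \<Longrightarrow> shrink_move G x e1 e2"
  by (intro shrink_move.intro shrink_move_axioms.intro plane_graph_axioms)

lemma two_valent_sum_zeroI:
  assumes "\<And>x e1 e2. two_valent G x e1 e2 \<Longrightarrow> \<kappa> e1 + \<kappa> e2 = 0"
  shows "two_valent_sum_zero G \<kappa>"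
  unfolding two_valent_sum_zero_def
proof (intro conjI ballI allI impI; elim conjE)
  fix w b1 b2
  assume w: "w \<in> white G" and "card (incident G w) = 2" "b1 \<noteq> b2"
    and b: "bend G ` incident G w = {b1, b2}"
  then obtain e1 e2 where e: "incident G w = {e1, e2}" "e1 \<noteq> e2" by (auto simp: card_2_iff)
  then have ends: "wend G e1 = w" "wend G e2 = w" using incident_white[OF w] by blast+
  have "{bend G e1, bend G e2} = {b1, b2}" using b e by simp
  then have b12: "b1 = bend G e1 \<and> b2 = bend G e2 \<or> b1 = bend G e2 \<and> b2 = bend G e1"
    by (auto simp: doubleton_eq_iff)
  have tv: "two_valent G w e1 e2"
    using w e ends b12 \<open>b1 \<noteq> b2\<close> by (auto simp: two_valent_def other_end_def)
  interpret shrink_move G w e1 e2 by (rule shrink_moveI[OF tv])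
  show "kast G \<kappa> w b1 + kast G \<kappa> w b2 = 0"
    using b12 assms[OF tv] kast_white[OF w, of \<kappa>] by (auto simp: add.commute)
next
  fix b w1 w2
  assume b: "b \<in> black G" and "card (incident G b) = 2" "w1 \<noteq> w2"
    and w: "wend G ` incident G b = {w1, w2}"
  then obtain e1 e2 where e: "incident G b = {e1, e2}" "e1 \<noteq> e2" by (auto simp: card_2_iff)
  then have ends: "bend G e1 = b" "bend G e2 = b" and "e1 \<in> E" "e2 \<in> E"
    using incident_black[OF b] by blast+
  then have "wend G e1 \<noteq> b" "wend G e2 \<noteq> b" using wend_not_black b by blast+
  have "{wend G e1, wend G e2} = {w1, w2}" using w e by simp
  then have w12: "w1 = wend G e1 \<and> w2 = wend G e2 \<or> w1 = wend G e2 \<and> w2 = wend G e1"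
    by (auto simp: doubleton_eq_iff)
  have tv: "two_valent G b e1 e2"
    using b e w12 \<open>w1 \<noteq> w2\<close> \<open>wend G e1 \<noteq> b\<close> \<open>wend G e2 \<noteq> b\<close>
    by (auto simp: two_valent_def other_end_def)
  interpret shrink_move G b e1 e2 by (rule shrink_moveI[OF tv])
  show "kast G \<kappa> w1 b + kast G \<kappa> w2 b = 0"
    using w12 assms[OF tv] kast_black[OF b, of \<kappa>] by (auto simp: add.commute)
qed

end

theorem proposition51:
  fixes G :: "('v, 'e) bigraph" and \<kappa> :: "'e \<Rightarrow> complex"
  assumes "plane_bigraph G"
    and "\<forall>e \<in> edges G. \<kappa> e \<noteq> 0"
  shows "(no_two_valent_bridge G \<longrightarrow> (partition_invariant G \<kappa> \<longleftrightarrow> two_valent_sum_zero G \<kappa>)) \<and>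
    (two_valent_sum_zero G \<kappa> \<longrightarrow> partition_invariant G \<kappa> \<and> kernel_invariant G \<kappa>)"
proof -
  interpret plane_graph G by (rule plane_graph.intro[OF assms(1)])
  have partition: "partition_invariant G \<kappa>" if sum_zero: "two_valent_sum_zero G \<kappa>"
    unfolding partition_invariant_def
  proof (intro allI impI)
    fix x e1 e2 assume "two_valent G x e1 e2"
    then interpret shrink_move G x e1 e2 by (rule shrink_moveI)
    have weights: "face_weight G \<kappa> f = face_weight G' \<kappa> (f - D)" if "f \<in> bounded_faces G" for f
      using face_weight_shrink_eq[OF sum_zero_at_x[OF sum_zero]] assms(2) e1_in that
      by (simp add: bounded_faces_def)
    then show "(\<forall>f\<in>bounded_faces G. face_weight G \<kappa> f = face_weight G' \<kappa> (f - D)) \<and>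
      (\<forall>M1. dimer_config G M1 \<longrightarrow> face_partition G \<kappa> M1 = face_partition G' \<kappa> (M1 - D))"
      using face_partition_shrink by blast
  qed
  have kernel: "kernel_invariant G \<kappa>" if sum_zero: "two_valent_sum_zero G \<kappa>"
    unfolding kernel_invariant_def
  proof (intro allI impI)
    fix x e1 e2 assume "two_valent G x e1 e2"
    then interpret shrink_move G x e1 e2 by (rule shrink_moveI)
    have "\<kappa> e1 + \<kappa> e2 = 0" "\<kappa> e1 \<noteq> 0" using sum_zero_at_x[OF sum_zero] assms(2) e1_in by auto
    then show "\<exists>\<Phi>. linear_iso (kast_ker G \<kappa>) (kast_ker G' \<kappa>) \<Phi> \<and>
      (\<forall>f \<in> kast_ker G \<kappa>. \<forall>b \<in> black G - {x}. \<Phi> f (merge G x e1 e2 b) = f b)"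
      using kernel_iso_white[of \<kappa>] kernel_iso_black[of \<kappa>] by (cases rule: colour_cases) auto
  qed
  have sum_zero: "two_valent_sum_zero G \<kappa>"
    if no_bridge: "no_two_valent_bridge G" and inv: "partition_invariant G \<kappa>"
  proof (rule two_valent_sum_zeroI)
    fix x e1 e2 assume tv: "two_valent G x e1 e2"
    then interpret shrink_move G x e1 e2 by (rule shrink_moveI)
    have "left_face G e1 \<noteq> right_face G e1"
      using no_bridge tv unfolding no_two_valent_bridge_def by blast
    then obtain f where f: "f \<in> bounded_faces G" "f \<inter> D = {e1} \<or> f \<inter> D = {e2}"
      by (rule bounded_face_on_one_side)
    have "face_weight G \<kappa> f = face_weight G' \<kappa> (f - D)"
      using inv tv f(1) unfolding partition_invariant_def by blast
    moreover have "f \<in> faces G" using f(1) by (simp add: bounded_faces_def)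
    ultimately show "\<kappa> e1 + \<kappa> e2 = 0"
      using sum_zero_if_face_weight_eq[of \<kappa> f] assms(2) f(2) by blast
  qed
  show ?thesis using partition kernel sum_zero by blast
qed

end
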